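(* Let $1\leqslant p<\infty$, let $f\in H^p$, and let $C:\mathbb Z^2\to\mathbb C$ be the discrete Cauchy kernel. Let $z_0\in\mathbb Z^2$. If $\operatorname{Im}(z_0)\geqslant 0$, then $$f(z_0)=\sum_{j=-\infty}^{+\infty}f(j)\,C(z_0-j).$$ If $\operatorname{Im}(z_0)<0$, then $$\sum_{j=-\infty}^{+\infty}f(j)\,C(z_0-j)=0.$$
   Context: Lattice points $(m,n)\in\mathbb Z^2$ are identified with $m+in\in\mathbb C$. Let $\mathbb Z^2_+=\{m+in: m,n\in\mathbb Z,\ n\geqslant 0\}$. A function $f:\mathbb Z^2_+\to\mathbb C$ is discrete holomorphic, written $f\in\operatorname{Hol}(\mathbb Z^2_+)$, if $f(z)+i f(z+1)-f(z+1+i)-i f(z+i)=0$ for every $z\in\mathbb Z^2_+$. For $1\leqslant p\leqslant\infty$, $H^p=H^p(\mathbb Z^2_+)=\{f\in\operatorname{Hol}(\mathbb Z^2_+): \|f\|_{H^p}:=\sup_{n\geqslant 0}\|f(\cdot+in)\|_{\ell^p(\mathbb Z)}<\infty\}$. Cauchy kernel: let $$q(m+in)=\frac1{(2\pi)^2}\int_0^{2\pi}\!\!\int_0^{2\pi}\frac{e^{i(mx+ny)}}{1+ie^{ix}-ie^{iy}-e^{i(x+y)}}\,dx\,dy,\qquad m+in\in\mathbb Z^2$$ (an absolutely convergent integral), and $C(z)=q(-z)+iq(1-z)$ for $z\in\mathbb Z^2$. Equivalently (a known fact), $C(m+in)=\frac1{2\pi}\int_0^\pi e^{imt}\left(\frac{\cos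 t}{1+\sin t}\right)^n dt$ for $n\geqslant 0$, and $C(m+in)=(-1)^{m+n+1}C(m+i|n|)$ for $n<0$. *)

theory Defs
  imports "HOL-Analysis.Analysis"
begin

text \<open>The lattice point \<open>m + in\<close> is encoded as the pair \<open>(m, n)\<close>, with the componentwise
  operations on \<^typ>\<open>int \<times> int\<close>; thus \<open>1\<close> and \<open>i\<close> become \<open>(1, 0)\<close> and \<open>(0, 1)\<close>.\<close>

type_synonym lattice = "int \<times> int"

definition upper_lattice :: "lattice set" where
  "upper_lattice = {z. snd z \<ge> 0}"

text \<open>Functions on the upper half-lattice are total functions whose values elsewhere
  are unconstrained.\<close>

definition Hol :: "(lattice \<Rightarrow> complex) set" where
  "Hol = {f. \<forall>z\<in>upper_lattice.
     f z + \<i> * f (z + (1, 0)) - f (z + (1, 1)) - \<i> * f (z + (0, 1)) = 0}"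

text \<open>Infinite sums in \<^typ>\<open>ennreal\<close> always exist, so the norm is \<open>\<infinity>\<close> exactly off
  \<open>\<ell>\<^sup>p\<close>; it is meant for \<open>1 \<le> p \<le> \<infinity>\<close>.\<close>

definition lp_norm :: "ennreal \<Rightarrow> (int \<Rightarrow> complex) \<Rightarrow> ennreal" where
  "lp_norm p g =
     (if p = \<infinity> then (SUP k. ennreal (norm (g k)))
      else let S = (\<Sum>\<^sub>\<infinity>k. ennreal (norm (g k) powr enn2real p))
           in if S = \<infinity> then \<infinity> else ennreal (enn2real S powr (1 / enn2real p)))"

definition Hp_norm :: "ennreal \<Rightarrow> (lattice \<Rightarrow> complex) \<Rightarrow> ennreal" where
  "Hp_norm p f = (SUP n\<in>{0..}. lp_norm p (\<lambda>m. f (m, n)))"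

definition Hp :: "ennreal \<Rightarrow> (lattice \<Rightarrow> complex) set" where
  "Hp p = {f \<in> Hol. Hp_norm p f < \<infinity>}"

text \<open>The denominator vanishes only on a finite subset of the square, where the integrand
  takes the value \<open>0\<close> by the convention for division.\<close>

definition q :: "lattice \<Rightarrow> complex" where
  "q = (\<lambda>(m, n). complex_of_real (1 / (2 * pi)\<^sup>2) *
     (LINT (x, y):{0..2 * pi} \<times> {0..2 * pi}|lborel.
        exp (\<i> * complex_of_real (of_int m * x + of_int n * y)) /
        (1 + \<i> * exp (\<i> * complex_of_real x) - \<i> * exp (\<i> * complex_of_real y)
           - exp (\<i> * complex_of_real (x + y)))))"

definition cauchy_kernel :: "lattice \<Rightarrow> complex" where
  "cauchy_kernel z = q (- z) + \<i> * q ((1, 0) - z)"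

end

theory Submission
  imports Defs
begin

text \<open>The discrete Cauchy-Riemann operator applied to \<open>q\<close> is a unit mass at the origin, so
  discrete Green's identity shows that the row sums \<open>S\<^sub>n = \<Sum>\<^sub>m f(m + in) C(z\<^sub>0 - m - in)\<close> are
  constant in \<open>n\<close>, except for a drop by \<open>f(z\<^sub>0)\<close> when passing the row of \<open>z\<^sub>0\<close>; the lateral
  boundary terms vanish because \<open>f\<close> tends to \<open>0\<close> along every row while \<open>q\<close> is bounded. It
  remains to see that \<open>S\<^sub>n\<close> tends to \<open>0\<close>. Up to a unimodular factor, \<open>C(m + in)\<close> is
  \<open>(2\<pi>)\<^bsup>-1\<^esup> \<integral>\<^sub>0\<^sup>\<pi> exp(-imt) (cos t / (1 + sin t))\<^bsup>|n|\<^esup> dt\<close>. By the second mean value theorem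
  it is \<open>O(1 / |m|)\<close> uniformly in \<open>n\<close>, by dominated convergence it tends to \<open>0\<close> uniformly in \<open>m\<close>
  as \<open>|n| \<rightarrow> \<infinity>\<close>, and these two bounds together make its \<open>\<ell>\<^sup>s\<close> norms along rows tend to \<open>0\<close> for every \<open>s > 1\<close>.\<close>

section \<open>Integrability of \<open>1 / sqrt \<bar>sin x\<bar>\<close> over a period\<close>

text \<open>Jordan's inequality: by concavity the graph of \<open>sin\<close> on
  \<open>{0..pi / 2}\<close> lies above its chord.\<close>

lemma two_pi_mult_le_sin:
  fixes x :: real
  assumes "0 \<le> x" "x \<le> pi / 2"
  shows "2 / pi * x \<le> sin x"
proof -
  have "concave_on {0..pi} sin"
  proof (rule f''_le0_imp_concave)
    show "\<And>x. x \<in> {0..pi} \<Longrightarrow> DERIV cos x :> - sin x"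
      by (auto intro!: derivative_eq_intros)
  qed (auto intro!: sin_ge_zero)
  then have "(1 - t) * sin 0 + t * sin (pi / 2) \<le> sin ((1 - t) * 0 + t * (pi / 2))"
    if "0 \<le> t" "t \<le> 1" for t :: real
    using that concave_onD[of "{0..pi}" sin t 0 "pi / 2"] by simp
  from this[of "2 / pi * x"] show ?thesis
    using assms by (simp add: field_simps)
qed

text \<open>By Jordan's inequality \<open>\<bar>sin x\<bar>\<close> is at least
  \<open>2 / pi\<close> times the distance from \<open>x\<close> to the nearest zero, so each
  singularity is no worse than that of \<open>t powr (- 1 / 2)\<close> at 0.\<close>

lemma integrable_inverse_sqrt_abs_sin:
  "integrable lborel (\<lambda>x. indicator {0..2 * pi} x * \<bar>sin x\<bar> powr (- 1 / 2))" (is "integrable _ ?w")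
proof -
  define V :: "real \<Rightarrow> real" where "V = (\<lambda>t. indicator {0..pi / 2} t * t powr (- 1 / 2))"
  have V0: "V t \<ge> 0" for t
    by (simp add: V_def)
  have "(\<lambda>t::real. t powr (- 1 / 2)) absolutely_integrable_on {0..pi / 2}"
    by (intro nonnegative_absolutely_integrable_1 integrable_on_powr_from_0) auto
  then have "integrable lebesgue V"
    by (simp add: set_integrable_def V_def)
  moreover have Vm: "V \<in> borel_measurable lborel"
    unfolding V_def by measurable
  ultimately have V: "integrable lborel V"
    by (simp add: integrable_completion)
  \<comment> \<open>On each quarter of \<open>{0..2 * pi}\<close> one of the four affine arguments
    is the distance from \<open>x\<close> to the nearest zero of \<open>sin\<close>. The shape
    \<open>c + t * x\<close> is that of the affine change of variables.\<close>
  define G where "G = (\<lambda>x. (2 / pi) powr (- 1 / 2) * (V (0 + 1 * x) + V (pi + (-1) * x) + V (-pi + 1 * x) + V (2 * pi + (-1) * x)))"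
  have G: "integrable lborel G"
    unfolding G_def
    by (intro integrable_mult_right Bochner_Integration.integrable_add lborel_integrable_real_affine V) auto
  have le: "?w x \<le> G x" for x
  proof (cases "x \<in> {0..2 * pi}")
    case True
    have *: "sin t powr (- 1 / 2) \<le> (2 / pi) powr (- 1 / 2) * V t" if t: "0 \<le> t" "t \<le> pi / 2" for t
    proof (cases "t = 0")
      case False
      with t have "sin t powr (- 1 / 2) \<le> (2 / pi * t) powr (- 1 / 2)"
        by (intro powr_mono2' two_pi_mult_le_sin) auto
      also have "\<dots> = (2 / pi) powr (- 1 / 2) * V t"
        using t by (subst powr_mult) (auto simp: V_def)
      finally show ?thesis .
    qed (simp add: V_def)
    have **: "(2 / pi) powr (- 1 / 2) * V t \<le> G x"
      if "t \<in> {0 + 1 * x, pi + (-1) * x, -pi + 1 * x, 2 * pi + (-1) * x}" for t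
      unfolding G_def using that V0 by (intro mult_left_mono) (auto intro: add_nonneg_nonneg)
    obtain t where t: "t \<in> {0 + 1 * x, pi + (-1) * x, -pi + 1 * x, 2 * pi + (-1) * x}"
        "0 \<le> t" "t \<le> pi / 2" "\<bar>sin x\<bar> = sin t"
    proof -
      consider "x \<le> pi / 2" | "pi / 2 \<le> x" "x \<le> pi" | "pi \<le> x" "x \<le> 3 * pi / 2" | "3 * pi / 2 \<le> x"
        by linarith
      then show ?thesis
      proof cases
        case 1
        with True have "sin x \<ge> 0" by (intro sin_ge_zero) auto
        with 1 True show ?thesis by (intro that[of x]) auto
      next
        case 2
        with True have "sin x \<ge> 0" by (intro sin_ge_zero) auto
        with 2 True show ?thesis by (intro that[of "pi - x"]) auto
      next
        case 3
        with True have "sin x \<le> 0" by (intro sin_le_zero) (use pi_gt_zero in linarith | simp)+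
        moreover have "sin (- pi + 1 * x) = - sin x" by (simp add: sin_add)
        ultimately show ?thesis using 3 True by (intro that[of "- pi + 1 * x"]) simp_all
      next
        case 4
        with True have "sin (2 * pi - x) \<ge> 0" by (intro sin_ge_zero) auto
        with 4 True show ?thesis by (intro that[of "2 * pi - x"]) (auto simp: sin_diff)
      qed
    qed
    with True *[of t] **[of t] show ?thesis by simp
  next
    case False
    then show ?thesis by (simp add: G_def V0)
  qed
  show ?thesis
    by (rule Bochner_Integration.integrable_bound[OF G])
      (use le in \<open>auto intro!: order_trans[OF _ abs_ge_self]\<close>)
qed

section \<open>The denominator of \<open>q\<close> and integrability of the double integrand\<close>

text \<open>The Fourier symbol of the discrete Cauchy-Riemann operator.\<close>

definition cauchy_denom :: "real \<Rightarrow> real \<Rightarrow> complex" where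
  "cauchy_denom x y = 1 + \<i> * cis x - \<i> * cis y - cis (x + y)"

text \<open>Being affine in \<open>cis y\<close>, the denominator turns into a two-term recurrence
  for the Fourier coefficients in \<open>y\<close> of its inverse.\<close>

lemma cauchy_denom_eq: "cauchy_denom x y = (1 + \<i> * cis x) - (\<i> + cis x) * cis y"
  by (simp add: cauchy_denom_def algebra_simps flip: cis_mult)

lemma norm_cauchy_denom_squared: "(norm (cauchy_denom x y))\<^sup>2 = 4 * (1 - cos x * cos y)"
proof -
  have "(norm (cauchy_denom x y))\<^sup>2 = (1 - sin x + sin y - cos (x + y))\<^sup>2 + (cos x - cos y - sin (x + y))\<^sup>2"
    by (simp add: cauchy_denom_def cmod_power2)
  moreover have "(sin x)\<^sup>2 + (cos x)\<^sup>2 = 1" "(sin y)\<^sup>2 + (cos y)\<^sup>2 = 1" by auto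
  ultimately show ?thesis
    unfolding cos_add sin_add by algebra
qed

text \<open>Adding the arithmetic-geometric inequalities for the sines and for the cosines gives
  \<open>\<bar>sin x * sin y\<bar> + cos x * cos y \<le> 1\<close>. The resulting bound is a product
  of a function of \<open>x\<close> and a function of \<open>y\<close>, so the double integral is
  controlled by one-variable integrals.\<close>

lemma norm_cauchy_denom_ge: "2 * (\<bar>sin x\<bar> powr (1/2) * \<bar>sin y\<bar> powr (1/2)) \<le> norm (cauchy_denom x y)"
proof (rule power2_le_imp_le)
  have "2 * \<bar>sin x * sin y\<bar> \<le> (sin x)\<^sup>2 + (sin y)\<^sup>2"
    using sum_squares_bound[of "\<bar>sin x\<bar>" "\<bar>sin y\<bar>"] by (simp add: abs_mult)
  moreover have "2 * (cos x * cos y) \<le> (cos x)\<^sup>2 + (cos y)\<^sup>2"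
    using sum_squares_bound[of "cos x" "cos y"] by simp
  ultimately have "\<bar>sin x * sin y\<bar> \<le> 1 - cos x * cos y"
    using sin_cos_squared_add[of x] sin_cos_squared_add[of y] by argo
  then show "(2 * (\<bar>sin x\<bar> powr (1/2) * \<bar>sin y\<bar> powr (1/2)))\<^sup>2 \<le> (norm (cauchy_denom x y))\<^sup>2"
    unfolding norm_cauchy_denom_squared by (simp add: powr_half_sqrt power_mult_distrib abs_mult)
qed auto

text \<open>A zero would force \<open>cos x * cos y = 1\<close>, hence
  \<open>\<bar>cos x\<bar> = 1\<close> and \<open>sin x = 0\<close>. So for almost every
  \<open>x\<close> the integrand is continuous in \<open>y\<close> without exception.\<close>

lemma cauchy_denom_nonzero: "sin x \<noteq> 0 \<Longrightarrow> cauchy_denom x y \<noteq> 0"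
proof
  assume "sin x \<noteq> 0" "cauchy_denom x y = 0"
  then have "cos x * cos y = 1"
    using norm_cauchy_denom_squared[of x y] by simp
  then have "\<bar>cos x\<bar> * \<bar>cos y\<bar> = 1" by (metis abs_mult abs_one)
  moreover have "\<bar>cos x\<bar> * \<bar>cos y\<bar> \<le> \<bar>cos x\<bar>" by (intro mult_left_le) auto
  ultimately have "\<bar>cos x\<bar> = 1" using abs_cos_le_one[of x] by linarith
  then have "(cos x)\<^sup>2 = 1" by (metis abs_power2 power2_abs one_power2)
  with \<open>sin x \<noteq> 0\<close> sin_cos_squared_add[of x] show False by simp
qed

lemma continuous_on_cauchy_denom [continuous_intros]:
  "continuous_on A f \<Longrightarrow> continuous_on A g \<Longrightarrow> continuous_on A (\<lambda>x. cauchy_denom (f x) (g x))"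
  unfolding cauchy_denom_def by (intro continuous_intros)

definition cauchy_integrand :: "int \<Rightarrow> int \<Rightarrow> real \<Rightarrow> real \<Rightarrow> complex" where
  "cauchy_integrand m n x y = cis (of_int m * x) * (cis (of_int n * y) / cauchy_denom x y)"

lemma cauchy_integrand_measurable [measurable]:
  "(\<lambda>z. cauchy_integrand m n (fst z) (snd z)) \<in> borel_measurable (borel \<Otimes>\<^sub>M borel)"
proof -
  have [measurable]: "(\<lambda>z::real\<times>real. cauchy_denom (fst z) (snd z)) \<in> borel_measurable borel"
      "(\<lambda>z::real\<times>real. cis (of_int m * fst z)) \<in> borel_measurable borel"
      "(\<lambda>z::real\<times>real. cis (of_int n * snd z)) \<in> borel_measurable borel"
    by (intro borel_measurable_continuous_onI continuous_intros)+
  show ?thesis unfolding cauchy_integrand_def borel_prod by measurable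
qed

text \<open>The excluded points are those where the denominator can vanish for some \<open>y\<close>
  (zeros of \<open>sin\<close>) and those where one of the coefficients
  \<open>1 + \<i> * cis x\<close> and \<open>\<i> + cis x\<close> vanishes (zeros of
  \<open>cos\<close>).\<close>

lemma AE_sin_cos_nonzero:
  "AE x in lborel. x \<in> {0..2 * pi} \<longrightarrow> sin x \<noteq> 0 \<and> cos x \<noteq> 0"
proof -
  have "AE x in lborel. x \<noteq> 0 \<and> x \<noteq> pi / 2 \<and> x \<noteq> pi \<and> x \<noteq> 3 * pi / 2 \<and> x \<noteq> 2 * pi"
    by (intro AE_conjI AE_lborel_singleton)
  then show ?thesis
  proof eventually_elim
    case (elim x)
    show ?case
    proof (intro impI conjI)
      assume x: "x \<in> {0..2 * pi}"
      show "sin x \<noteq> 0"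
      proof (cases "x < pi")
        case True
        then show ?thesis using x elim sin_gt_zero[of x] by auto
      next
        case False
        then show ?thesis using x elim sin_lt_zero[of x] by auto
      qed
      show "cos x \<noteq> 0"
      proof -
        consider "x < pi / 2" | "pi / 2 < x" "x < 3 * pi / 2" | "3 * pi / 2 < x"
          using elim by linarith
        then show ?thesis
        proof cases
          case 1 then show ?thesis using x cos_gt_zero_pi[of x] by auto
        next
          case 2 then show ?thesis using cos_gt_zero_pi[of "x - pi"] by (auto simp: cos_diff)
        next
          case 3 then show ?thesis using x cos_gt_zero_pi[of "x - 2 * pi"] by (auto simp: cos_diff)
        qed
      qed
    qed
  qed
qed

lemma cauchy_integrand_integrable:
  "integrable (lborel \<Otimes>\<^sub>M lborel)
     (\<lambda>(x, y). indicator {0..2 * pi} x *\<^sub>R indicator {0..2 * pi} y *\<^sub>R cauchy_integrand m n x y)"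
  (is "integrable _ ?F")
proof -
  define w :: "real \<Rightarrow> real" where "w = (\<lambda>x. indicator {0..2 * pi} x * \<bar>sin x\<bar> powr (- 1 / 2))"
  have w: "integrable lborel w"
    using integrable_inverse_sqrt_abs_sin by (simp add: w_def)
  have w0: "w x \<ge> 0" for x by (simp add: w_def)
  have [measurable]: "w \<in> borel_measurable borel"
    using borel_measurable_integrable[OF w] by simp
  have F[measurable]: "?F \<in> borel_measurable (lborel \<Otimes>\<^sub>M lborel)"
    using cauchy_integrand_measurable[of m n] by (simp add: case_prod_beta')
  \<comment> \<open>At a zero of \<open>sin\<close> the weight \<open>w\<close> is 0, because
    \<open>0 powr c = 0\<close>, and the bound can fail. It is therefore claimed only off these
    zeros.\<close>
  have bound: "norm (?F (x, y)) \<le> w x * w y"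
    if "y \<in> {0..2 * pi} \<longrightarrow> sin y \<noteq> 0" "x \<in> {0..2 * pi} \<longrightarrow> sin x \<noteq> 0" for x y
  proof (cases "x \<in> {0..2 * pi} \<and> y \<in> {0..2 * pi}")
    case True
    with that have s: "sin x \<noteq> 0" "sin y \<noteq> 0" by auto
    have "1 / norm (cauchy_denom x y) \<le> 1 / (2 * (\<bar>sin x\<bar> powr (1/2) * \<bar>sin y\<bar> powr (1/2)))"
      using s by (intro divide_left_mono norm_cauchy_denom_ge mult_pos_pos)
        (auto simp: cauchy_denom_nonzero)
    also have "\<dots> \<le> 1 / (\<bar>sin x\<bar> powr (1/2) * \<bar>sin y\<bar> powr (1/2))"
      using s by (intro divide_left_mono) auto
    also have "\<dots> = w x * w y"
      using True by (simp add: w_def powr_minus field_simps)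
    finally show ?thesis using True by (simp add: cauchy_integrand_def norm_mult norm_divide)
  qed (auto simp: w0)
  show ?thesis
  proof (rule lborel_pair.Fubini_integrable)
    have AEx: "AE x in lborel. AE y in lborel. norm (?F (x, y)) \<le> w x * w y"
      using AE_sin_cos_nonzero
    proof eventually_elim
      case (elim x)
      show ?case using AE_sin_cos_nonzero by eventually_elim (use bound elim in blast)
    qed
    have int: "AE x in lborel. integrable lborel (\<lambda>y. ?F (x, y))"
      using AEx
    proof eventually_elim
      case (elim x)
      show ?case
      proof (rule Bochner_Integration.integrable_bound)
        show "integrable lborel (\<lambda>y. w x * w y)" using w by simp
        show "AE y in lborel. norm (?F (x, y)) \<le> norm (w x * w y)"
          using elim by eventually_elim (auto simp: abs_mult w0)
      qed (use F in measurable)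
    qed
    then show "AE x in lborel. integrable lborel (\<lambda>y. ?F (x, y))" .
    show "integrable lborel (\<lambda>x. \<integral>y. norm (?F (x, y)) \<partial>lborel)"
    proof (rule Bochner_Integration.integrable_bound)
      show "integrable lborel (\<lambda>x. w x * integral\<^sup>L lborel w)" using w by simp
      show "(\<lambda>x. \<integral>y. norm (?F (x, y)) \<partial>lborel) \<in> borel_measurable lborel"
        using F by measurable
      show "AE x in lborel. norm (\<integral>y. norm (?F (x, y)) \<partial>lborel) \<le> norm (w x * integral\<^sup>L lborel w)"
        using AEx int
      proof eventually_elim
        case (elim x)
        have "(\<integral>y. norm (?F (x, y)) \<partial>lborel) \<le> (\<integral>y. w x * w y \<partial>lborel)"
        proof (rule integral_mono_AE)
          show "integrable lborel (\<lambda>y. norm (?F (x, y)))" by (rule integrable_norm) (fact elim)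
        qed (use elim w in auto)
        moreover have "0 \<le> (\<integral>y. norm (?F (x, y)) \<partial>lborel)" by simp
        moreover have "0 \<le> w x * integral\<^sup>L lborel w"
          by (intro mult_nonneg_nonneg w0) (simp add: w0)
        ultimately show ?case by (simp del: integral_nonneg_AE)
      qed
    qed
  qed (rule F)
qed

section \<open>The integral over \<open>y\<close> in closed form\<close>

lemma set_integral_cis_of_int:
  "(LINT y:{0..2 * pi}|lborel. cis (of_int n * y)) = (if n = 0 then complex_of_real (2 * pi) else 0)"
proof -
  have c: "continuous_on {0..2 * pi} (\<lambda>y. cis (of_int n * y))"
    by (intro continuous_intros)
  have "(LINT y:{0..2 * pi}|lborel. cis (of_int n * y)) = integral {0..2 * pi} (\<lambda>y. cis (of_int n * y))"
    by (intro set_borel_integral_eq_integral borel_integrable_atLeastAtMost' c)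
  also have "\<dots> = (if n = 0 then complex_of_real (2 * pi) else 0)"
  proof (cases "n = 0")
    case False
    have "((\<lambda>y. cis (of_int n * y)) has_integral
            (- \<i> / of_int n * cis (of_int n * (2 * pi)) - - \<i> / of_int n * cis (of_int n * 0))) {0..2 * pi}"
    proof (rule fundamental_theorem_of_calculus)
      fix y
      have ii: "\<i> * (z * \<i>) = - z" for z
        by (metis complex_i_mult_minus mult.commute)
      have "((\<lambda>z. - \<i> / of_int n * exp (\<i> * of_int n * z)) has_field_derivative
          exp (\<i> * of_int n * of_real y)) (at (complex_of_real y))"
        by (rule derivative_eq_intros refl | use False in \<open>simp add: ii\<close>)+
      then have "((\<lambda>y. - \<i> / of_int n * exp (\<i> * of_int n * of_real y)) has_vector_derivative
          exp (\<i> * of_int n * of_real y)) (at y within {0..2 * pi})"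
        by (rule has_vector_derivative_real_field)
      then show "((\<lambda>y. - \<i> / of_int n * cis (of_int n * y)) has_vector_derivative cis (of_int n * y))
              (at y within {0..2 * pi})"
        using False by (simp add: cis_conv_exp mult.assoc)
    qed simp
    moreover have "cis (of_int n * (2 * pi)) = 1"
      using cis_multiple_2pi[of "of_int n"] by (simp add: mult_ac)
    ultimately show ?thesis using False by (simp add: integral_unique)
  qed (simp add: scaleR_conv_of_real)
  finally show ?thesis .
qed

text \<open>Boundedness at \<open>-\<infinity>\<close> selects the solution of the recurrence that vanishes there.\<close>

lemma bounded_two_sided_recurrence:
  fixes J :: "int \<Rightarrow> 'a::real_normed_field"
  assumes ab: "norm a < norm b"
    and rec: "\<And>n. a * J n - b * J (n + 1) = (if n = 0 then c else 0)"
    and bound: "\<And>n. norm (J n) \<le> B"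
  shows "n \<le> 0 \<Longrightarrow> J n = 0"
    and "k > 0 \<Longrightarrow> a * J (int k) = - c * (a / b) ^ k"
proof -
  have b: "b \<noteq> 0" using ab by auto
  define r where "r = a / b"
  have r: "norm r < 1" using ab b by (simp add: r_def norm_divide)
  have step: "J (n + 1) = r * J n" if "n \<noteq> 0" for n
    using rec[of n] that b by (simp add: r_def divide_simps mult.commute)
  have zero: "J n = 0" if n: "n \<le> 0" for n
  proof -
    \<comment> \<open>Going backwards from \<open>n \<le> 0\<close> only uses the recurrence at
      negative indices, so its inhomogeneous term at 0 is never met.\<close>
    have "J n = r ^ k * J (n - int k)" for k
    proof (induction k)
      case (Suc k)
      have "J (n - int k) = r * J (n - int (Suc k))"
        using step[of "n - int (Suc k)"] n by simp
      then show ?case using Suc by simp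
    qed simp
    then have "norm (J n) = norm r ^ k * norm (J (n - int k))" for k
      by (metis norm_mult norm_power)
    then have "norm (J n) \<le> norm r ^ k * B" for k
      using mult_left_mono[OF bound[of "n - int k"], of "norm r ^ k"] by simp
    moreover have "(\<lambda>k. norm r ^ k * B) \<longlonglongrightarrow> 0"
      using r by (intro tendsto_mult_left_zero LIMSEQ_power_zero) simp
    ultimately have "norm (J n) \<le> 0"
      by (intro LIMSEQ_le_const) auto
    then show ?thesis by simp
  qed
  show "J n = 0" if "n \<le> 0" using zero that .
  show "a * J (int k) = - c * (a / b) ^ k" if "k > 0"
    using that
  proof (induction k rule: nat_induct_non_zero)
    case 1
    have "b * J 1 = - c" using rec[of 0] zero[of 0] by (simp add: minus_equation_iff)
    then have "J 1 = - c / b" using b by (simp add: field_simps)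
    then show ?case by simp
  next
    case (Suc k)
    have "J (int (Suc k)) = r * J (int k)"
      using step[of "int k"] Suc.hyps by (simp add: add.commute)
    then have "a * J (int (Suc k)) = r * (a * J (int k))" by simp
    also have "\<dots> = r * (- c * r ^ k)" unfolding Suc.IH r_def ..
    finally show ?case by (simp add: r_def)
  qed
qed

definition inner_integral :: "int \<Rightarrow> real \<Rightarrow> complex" where
  "inner_integral n x = (LINT y:{0..2 * pi}|lborel. cis (of_int n * y) / cauchy_denom x y)"

lemma inner_integral_integrable:
  assumes "sin x \<noteq> 0"
  shows "set_integrable lborel {0..2 * pi} (\<lambda>y. cis (of_int n * y) / cauchy_denom x y)"
  using assms
  by (intro borel_integrable_atLeastAtMost' continuous_intros) (auto simp: cauchy_denom_nonzero)

text \<open>By \<open>cauchy_denom_eq\<close> the combination of the two numerators is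
  \<open>cis (n * y)\<close> times the denominator. The denominator cancels and orthogonality of the
  exponentials remains.\<close>

lemma inner_integral_recurrence:
  assumes "sin x \<noteq> 0"
  shows "(1 + \<i> * cis x) * inner_integral n x - (\<i> + cis x) * inner_integral (n + 1) x =
    (if n = 0 then complex_of_real (2 * pi) else 0)"
proof -
  have "(1 + \<i> * cis x) * inner_integral n x - (\<i> + cis x) * inner_integral (n + 1) x =
    (LINT y:{0..2 * pi}|lborel. (1 + \<i> * cis x) * (cis (of_int n * y) / cauchy_denom x y)
        - (\<i> + cis x) * (cis (of_int (n + 1) * y) / cauchy_denom x y))"
    unfolding inner_integral_def set_integral_mult_right[symmetric]
    by (intro set_integral_diff(2)[symmetric] set_integrable_mult_right inner_integral_integrable assms)
  also have "\<dots> = (LINT y:{0..2 * pi}|lborel. cis (of_int n * y))"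
  proof (intro set_lebesgue_integral_cong allI impI)
    fix y
    have "(1 + \<i> * cis x) * cis (of_int n * y) - (\<i> + cis x) * cis (of_int (n + 1) * y)
        = cis (of_int n * y) * cauchy_denom x y"
    proof -
      have "cis (of_int (n + 1) * y) = cis (of_int n * y) * cis y"
        by (simp add: cis_mult distrib_right)
      then show ?thesis by (simp add: cauchy_denom_eq algebra_simps)
    qed
    moreover have "a * (c / d) - b * (e / d) = c"
      if "a * c - b * e = c * d" "d \<noteq> 0" for a b c d e :: complex
      using that by (simp flip: diff_divide_distrib)
    ultimately show "(1 + \<i> * cis x) * (cis (of_int n * y) / cauchy_denom x y)
        - (\<i> + cis x) * (cis (of_int (n + 1) * y) / cauchy_denom x y) = cis (of_int n * y)"
      using cauchy_denom_nonzero[OF assms, of y] by blast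
  qed simp
  finally show ?thesis by (simp only: set_integral_cis_of_int)
qed

text \<open>The bound is the same for all \<open>n\<close>, which singles out the solution of the
  recurrence.\<close>

lemma norm_inner_integral_le:
  assumes "sin x \<noteq> 0"
  shows "norm (inner_integral n x) \<le> (LINT y:{0..2 * pi}|lborel. 1 / norm (cauchy_denom x y))"
proof -
  have "norm (inner_integral n x) \<le> (LINT y:{0..2 * pi}|lborel. norm (cis (of_int n * y) / cauchy_denom x y))"
    unfolding inner_integral_def
    by (intro set_integral_norm_bound inner_integral_integrable assms)
  then show ?thesis by (simp add: norm_divide)
qed

text \<open>With \<open>a = 1 + \<i> * cis x\<close> and \<open>b = \<i> + cis x\<close> the squared
  norms are \<open>2 - 2 * sin x\<close> and \<open>2 + 2 * sin x\<close>. The sign of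
  \<open>sin x\<close> thus decides on which side the bounded solution of the recurrence vanishes,
  and \<open>a / b\<close> is the real number \<open>cos x / (1 + sin x)\<close>. The factor
  \<open>a\<close> is kept on the left because the combination of two values of \<open>q\<close>
  that defines the Cauchy kernel produces exactly this factor.\<close>

lemma inner_integral_closed_form:
  assumes "sin x \<noteq> 0" "cos x \<noteq> 0"
  shows "(1 + \<i> * cis x) * inner_integral n x =
    (if sin x > 0 then (if n \<le> 0 then 0 else - (2 * pi) * (cos x / (1 + sin x)) ^ nat n)
     else (if n \<le> 0 then 2 * pi * (cos x / (1 - sin x)) ^ nat (- n) else 0))"
proof -
  define a b J where "a = 1 + \<i> * cis x" and "b = \<i> + cis x" and "J = (\<lambda>n. inner_integral n x)"
  have s: "\<bar>sin x\<bar> < 1"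
  proof -
    have "(cos x)\<^sup>2 > 0" using assms by simp
    then have "(sin x)\<^sup>2 < 1" using sin_cos_squared_add[of x] by linarith
    then show ?thesis by (simp add: abs_square_less_1)
  qed
  have cc: "cos x * cos x = (1 - sin x) * (1 + sin x)"
    using sin_cos_squared_add[of x] by (simp add: power2_eq_square algebra_simps)
  have s1: "1 + sin x \<noteq> 0" "1 - sin x \<noteq> 0" using s by auto
  have ba: "b * (cos x / (1 + sin x)) = a"
  proof (rule complex_eqI)
    show "Re (b * (cos x / (1 + sin x))) = Re a" using s1 by (simp add: a_def b_def cc)
    show "Im (b * (cos x / (1 + sin x))) = Im a" using s1 by (simp add: a_def b_def)
  qed
  have ab: "a * (cos x / (1 - sin x)) = b"
  proof (rule complex_eqI)
    show "Re (a * (cos x / (1 - sin x))) = Re b" using s1 by (simp add: a_def b_def)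
    show "Im (a * (cos x / (1 - sin x))) = Im b" using s1 by (simp add: a_def b_def cc)
  qed
  have norms: "(norm a)\<^sup>2 = 2 - 2 * sin x" "(norm b)\<^sup>2 = 2 + 2 * sin x"
    unfolding cmod_power2 a_def b_def
    using cc by (simp_all add: power2_eq_square algebra_simps)
  have nz: "a \<noteq> 0" "b \<noteq> 0"
    using norms s1 by (auto simp del: power2_eq_square)
  have rec: "a * J n - b * J (n + 1) =
      (if n = 0 then complex_of_real (2 * pi) else 0)" for n
    unfolding J_def a_def b_def by (rule inner_integral_recurrence[OF assms(1)])
  have bound: "norm (J n) \<le> (LINT y:{0..2 * pi}|lborel. 1 / norm (cauchy_denom x y))" for n
    unfolding J_def by (rule norm_inner_integral_le[OF assms(1)])
  have "a * J n =
    (if sin x > 0 then (if n \<le> 0 then 0 else - (2 * pi) * (cos x / (1 + sin x)) ^ nat n)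
     else (if n \<le> 0 then 2 * pi * (cos x / (1 - sin x)) ^ nat (- n) else 0))"
  proof (cases "sin x > 0")
    case True
    have "norm a < norm b"
      by (rule power2_less_imp_less) (use norms True in simp_all)
    note * = bounded_two_sided_recurrence[OF this rec bound]
    show ?thesis
    proof (cases "n \<le> 0")
      case True
      with \<open>sin x > 0\<close> show ?thesis by (simp add: *(1))
    next
      case False
      have "a / b = of_real (cos x / (1 + sin x))"
        unfolding ba[symmetric] using nz by simp
      then show ?thesis using *(2)[of "nat n"] False \<open>sin x > 0\<close> by simp
    qed
  next
    case False
    have "norm b < norm a"
      by (rule power2_less_imp_less) (use norms False assms in simp_all)
    \<comment> \<open>The reflection of \<open>n\<close> to \<open>1 - n\<close> exchanges
      \<open>a\<close> and \<open>b\<close>, keeps the source at index 0 and changes its sign, so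
      the solution that vanishes on the positive side falls under the same lemma.\<close>
    moreover have "b * J (1 - n) - a * J (1 - (n + 1)) = (if n = 0 then - complex_of_real (2 * pi) else 0)" for n
      using rec[of "- n"] by (simp add: minus_equation_iff algebra_simps split: if_splits)
    ultimately have *: "n \<le> 0 \<Longrightarrow> J (1 - n) = 0"
        "k > 0 \<Longrightarrow> b * J (1 - int k) = - (- complex_of_real (2 * pi)) * (b / a) ^ k" for n k
      using bounded_two_sided_recurrence[of b a "\<lambda>n. J (1 - n)", OF _ _ bound] by blast+
    show ?thesis
    proof (cases "n \<le> 0")
      case True
      define c where "c = cos x / (1 - sin x)"
      have c: "b / a = of_real c"
        unfolding ab[symmetric] c_def using nz by simp
      \<comment> \<open>The reflected formula gives \<open>b * J n\<close> with the exponent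
        \<open>1 - n\<close>. Cancelling \<open>b\<close> uses up one power of \<open>b / a\<close>
        and leaves \<open>a * J n\<close> with the exponent \<open>- n\<close>.\<close>
      have "1 - int (Suc (nat (- n))) = n" using True by simp
      then have "b * J n = 2 * pi * (b / a) ^ Suc (nat (- n))"
        using *(2)[of "Suc (nat (- n))"] by simp
      then have "a * (b * J n) = a * ((b / a) * (2 * pi * (b / a) ^ nat (- n)))"
        by simp
      also have "\<dots> = b * (2 * pi * (b / a) ^ nat (- n))"
        using nz(1) by simp
      finally have "b * (a * J n) = b * (2 * pi * (b / a) ^ nat (- n))"
        by (simp only: mult.left_commute)
      then have "a * J n = 2 * pi * (b / a) ^ nat (- n)"
        using nz(2) by simp
      then show ?thesis
        using True False by (simp add: c c_def[symmetric])
    next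
      case False
      then show ?thesis
        using *(1)[of "1 - n"] \<open>\<not> sin x > 0\<close> by simp
    qed
  qed
  then show ?thesis by (simp only: a_def J_def)
qed

section \<open>\<open>q\<close> as a bounded fundamental solution\<close>

lemma q_eq_integral:
  "q (m, n) = of_real (1 / (2 * pi)\<^sup>2) * (\<integral>(x, y). indicator {0..2 * pi} x *\<^sub>R
      indicator {0..2 * pi} y *\<^sub>R cauchy_integrand m n x y \<partial>(lborel \<Otimes>\<^sub>M lborel))"
  unfolding lborel_prod
  by (auto simp: q_def set_lebesgue_integral_def cauchy_integrand_def cauchy_denom_def cis_conv_exp
      case_prod_beta' indicator_times exp_add distrib_left mem_Times_iff
      intro!: Bochner_Integration.integral_cong split: split_indicator)

lemma q_eq_iterated:
  "integrable lborel (\<lambda>x. indicator {0..2 * pi} x *\<^sub>R (cis (of_int m * x) * inner_integral n x))"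
  "q (m, n) = of_real (1 / (2 * pi)\<^sup>2) *
      (\<integral>x. indicator {0..2 * pi} x *\<^sub>R (cis (of_int m * x) * inner_integral n x) \<partial>lborel)"
proof -
  let ?F = "\<lambda>(x, y). indicator {0..2 * pi} x *\<^sub>R indicator {0..2 * pi} y *\<^sub>R cauchy_integrand m n x y"
  have *: "(\<integral>y. ?F (x, y) \<partial>lborel) = indicator {0..2 * pi} x *\<^sub>R (cis (of_int m * x) * inner_integral n x)" for x
  proof -
    have "(\<integral>y. ?F (x, y) \<partial>lborel) = (\<integral>y. (indicator {0..2 * pi} x *\<^sub>R cis (of_int m * x)) *
        (indicator {0..2 * pi} y *\<^sub>R (cis (of_int n * y) / cauchy_denom x y)) \<partial>lborel)"
      by (rule Bochner_Integration.integral_cong) (auto simp: cauchy_integrand_def indicator_def)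
    also have "\<dots> = (indicator {0..2 * pi} x *\<^sub>R cis (of_int m * x)) * inner_integral n x"
      unfolding inner_integral_def set_lebesgue_integral_def by (rule integral_mult_right_zero)
    finally show ?thesis by simp
  qed
  show "integrable lborel (\<lambda>x. indicator {0..2 * pi} x *\<^sub>R (cis (of_int m * x) * inner_integral n x))"
    using lborel_pair.integrable_fst'[OF cauchy_integrand_integrable[of m n]] unfolding * .
  have "(\<integral>z. ?F z \<partial>(lborel \<Otimes>\<^sub>M lborel)) = (\<integral>x. (\<integral>y. ?F (x, y) \<partial>lborel) \<partial>lborel)"
    using lborel_pair.integral_fst'[OF cauchy_integrand_integrable[of m n]] by simp
  then show "q (m, n) = of_real (1 / (2 * pi)\<^sup>2) *
      (\<integral>x. indicator {0..2 * pi} x *\<^sub>R (cis (of_int m * x) * inner_integral n x) \<partial>lborel)"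
    unfolding * q_eq_integral by (rule arg_cong)
qed

text \<open>The exponentials have modulus 1, so the absolute value of the integrand does not depend
  on the lattice point.\<close>

lemma q_bounded: "\<exists>B. \<forall>z. norm (q z) \<le> B"
proof -
  let ?F = "\<lambda>m n (x, y). indicator {0..2 * pi} x *\<^sub>R indicator {0..2 * pi} y *\<^sub>R cauchy_integrand m n x y"
  let ?B = "1 / (2 * pi)\<^sup>2 * (\<integral>z. norm (?F 0 0 z) \<partial>(lborel \<Otimes>\<^sub>M lborel))"
  have "norm (q (m, n)) \<le> ?B" for m n
  proof -
    have "norm (q (m, n)) = 1 / (2 * pi)\<^sup>2 * norm (\<integral>z. ?F m n z \<partial>(lborel \<Otimes>\<^sub>M lborel))"
      unfolding q_eq_integral by (simp add: norm_mult norm_divide norm_power)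
    also have "\<dots> \<le> 1 / (2 * pi)\<^sup>2 * (\<integral>z. norm (?F m n z) \<partial>(lborel \<Otimes>\<^sub>M lborel))"
      by (intro mult_left_mono integral_norm_bound) simp
    also have "(\<lambda>z. norm (?F m n z)) = (\<lambda>z. norm (?F 0 0 z))"
      by (auto simp: cauchy_integrand_def norm_mult norm_divide)
    finally show ?thesis .
  qed
  then show ?thesis by (intro exI[of _ ?B]) auto
qed

text \<open>Under the integral over \<open>x\<close> the combination becomes
  \<open>cis (m * x)\<close> times the left side of \<open>inner_integral_recurrence\<close>, almost
  everywhere. What is left is an orthogonality integral in \<open>x\<close>.\<close>

lemma q_discrete_cauchy_riemann:
  "q (m, n) + \<i> * q (m + 1, n) - \<i> * q (m, n + 1) - q (m + 1, n + 1) = of_bool (m = 0 \<and> n = 0)"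
proof -
  define G where "G = (\<lambda>m n x. indicator {0..2 * pi} x *\<^sub>R (cis (of_int m * x) * inner_integral n x))"
  have G: "integrable lborel (G m n)" and q: "q (m, n) = of_real (1 / (2 * pi)\<^sup>2) * (\<integral>x. G m n x \<partial>lborel)" for m n
    unfolding G_def by (fact q_eq_iterated)+
  have "q (m, n) + \<i> * q (m + 1, n) - \<i> * q (m, n + 1) - q (m + 1, n + 1) =
    of_real (1 / (2 * pi)\<^sup>2) * (\<integral>x. G m n x + \<i> * G (m + 1) n x - \<i> * G m (n + 1) x - G (m + 1) (n + 1) x \<partial>lborel)"
    unfolding q
    by (simp only: G Bochner_Integration.integral_add Bochner_Integration.integral_diff
        integral_mult_right_zero Bochner_Integration.integrable_add Bochner_Integration.integrable_diff
        integrable_mult_right ring_distribs mult.left_commute[of \<i>])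
  also have "(\<integral>x. G m n x + \<i> * G (m + 1) n x - \<i> * G m (n + 1) x - G (m + 1) (n + 1) x \<partial>lborel) =
     (\<integral>x. (if n = 0 then of_real (2 * pi) else 0) * (indicator {0..2 * pi} x *\<^sub>R cis (of_int m * x)) \<partial>lborel)"
  proof (rule integral_cong_AE)
    show "AE x in lborel. G m n x + \<i> * G (m + 1) n x - \<i> * G m (n + 1) x - G (m + 1) (n + 1) x =
       (if n = 0 then of_real (2 * pi) else 0) * (indicator {0..2 * pi} x *\<^sub>R cis (of_int m * x))"
      using AE_sin_cos_nonzero
    proof eventually_elim
      case (elim x)
      show ?case
      proof (cases "x \<in> {0..2 * pi}")
        case True
        then have "G m n x + \<i> * G (m + 1) n x - \<i> * G m (n + 1) x - G (m + 1) (n + 1) x =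
          cis (of_int m * x) * ((1 + \<i> * cis x) * inner_integral n x - (\<i> + cis x) * inner_integral (n + 1) x)"
          by (simp add: G_def algebra_simps flip: cis_mult)
        also have "\<dots> = cis (of_int m * x) * (if n = 0 then of_real (2 * pi) else 0)"
          using elim True by (subst inner_integral_recurrence) auto
        finally show ?thesis using True by simp
      qed (auto simp: G_def)
    qed
    have [measurable]: "(\<lambda>x::real. cis (of_int m * x)) \<in> borel_measurable borel"
      by (intro borel_measurable_continuous_onI continuous_intros)
    show "(\<lambda>x. (if n = 0 then of_real (2 * pi) else 0) * (indicator {0..2 * pi} x *\<^sub>R cis (of_int m * x)))
        \<in> borel_measurable lborel"
      by measurable
  qed (use G[THEN borel_measurable_integrable] in measurable)
  also have "\<dots> = (if n = 0 then of_real (2 * pi) else 0) * (if m = 0 then of_real (2 * pi) else 0)"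
    using set_integral_cis_of_int[of m, unfolded set_lebesgue_integral_def]
    by (simp only: integral_mult_right_zero)
  finally show ?thesis by (simp add: power2_eq_square)
qed

section \<open>Decay of the oscillatory integral behind the Cauchy kernel\<close>

definition kernel_ratio :: "real \<Rightarrow> real" where
  "kernel_ratio t = cos t / (1 + sin t)"

text \<open>The complex conjugate of the classical integral for \<open>2 * pi\<close> times the
  kernel at \<open>m + in\<close> with \<open>n \<ge> 0\<close>. Only its norm matters
  below.\<close>

definition kernel_integral :: "int \<Rightarrow> nat \<Rightarrow> complex" where
  "kernel_integral m n = integral {0..pi} (\<lambda>t. cis (- of_int m * t) * of_real (kernel_ratio t ^ n))"

lemma continuous_on_kernel_ratio: "continuous_on {0..pi} kernel_ratio"
  unfolding kernel_ratio_def
proof (intro continuous_intros ballI)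
  fix t assume "t \<in> {0..pi}"
  then have "sin t \<ge> 0" by (intro sin_ge_zero) auto
  then show "1 + sin t \<noteq> 0" by linarith
qed

lemma kernel_integrand_continuous:
  "continuous_on {0..pi} (\<lambda>t. cis (- of_int m * t) * of_real (kernel_ratio t ^ n))"
  by (intro continuous_intros continuous_on_kernel_ratio)

lemma abs_kernel_ratio_le_one:
  assumes "0 \<le> t" "t \<le> pi"
  shows "\<bar>kernel_ratio t\<bar> \<le> 1"
proof -
  have "sin t \<ge> 0" using assms by (intro sin_ge_zero) auto
  then have "\<bar>cos t\<bar> \<le> 1 + sin t" using abs_cos_le_one[of t] by linarith
  with \<open>sin t \<ge> 0\<close> show ?thesis by (simp add: kernel_ratio_def)
qed

text \<open>The second mean value theorem moves the monotone factor out of the real and the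
  imaginary part. The primitives of the trigonometric factors are bounded by
  \<open>1 / \<bar>m\<bar>\<close>, so each of the two resulting integrals is at most
  \<open>2 / \<bar>m\<bar>\<close>, and two terms in each of two parts give 8.\<close>

lemma norm_le_of_monotone_oscillation:
  fixes g :: "real \<Rightarrow> real" and m :: int
  assumes ab: "a \<le> b" and cont: "continuous_on {a..b} g" and m: "m \<noteq> 0"
    and mono: "\<And>x y. a \<le> x \<Longrightarrow> x \<le> y \<Longrightarrow> y \<le> b \<Longrightarrow> g x \<le> g y"
    and bound: "\<And>x. a \<le> x \<Longrightarrow> x \<le> b \<Longrightarrow> \<bar>g x\<bar> \<le> 1"
  shows "norm (integral {a..b} (\<lambda>t. cis (- of_int m * t) * of_real (g t))) \<le> 8 / \<bar>real_of_int m\<bar>"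
proof -
  define f where "f = (\<lambda>t. cis (- of_int m * t) * of_real (g t))"
  have f: "f integrable_on {a..b}"
    unfolding f_def by (intro integrable_continuous_real continuous_intros cont)
  have part: "\<bar>integral {a..b} (\<lambda>t. g t * h t)\<bar> \<le> 4 / \<bar>real_of_int m\<bar>"
    if H: "\<And>x. (H has_field_derivative h x) (at x)" "\<And>x. \<bar>H x\<bar> \<le> 1 / \<bar>real_of_int m\<bar>" for h H :: "real \<Rightarrow> real"
  proof -
    have int: "(h has_integral (H d - H c)) {c..d}" if "c \<le> d" for c d
    proof (rule fundamental_theorem_of_calculus[OF that])
      show "(H has_vector_derivative h x) (at x within {c..d})" for x
        using has_field_derivative_at_within[OF H(1)] by (simp add: has_real_derivative_iff_has_vector_derivative)
    qed
    have le: "\<bar>integral {c..d} h\<bar> \<le> 2 / \<bar>real_of_int m\<bar>" if "c \<le> d" for c d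
      unfolding integral_unique[OF int[OF that]] using H(2)[of c] H(2)[of d] by linarith
    obtain c where c: "c \<in> {a..b}"
      "integral {a..b} (\<lambda>x. g x * h x) = g a * integral {a..c} h + g b * integral {c..b} h"
      using second_mean_value_theorem[of h a b g] int[OF ab] ab mono by (metis has_integral_integrable)
    have "\<bar>g a * integral {a..c} h\<bar> \<le> 1 * (2 / \<bar>real_of_int m\<bar>)"
      unfolding abs_mult using c ab by (intro mult_mono bound le) auto
    moreover have "\<bar>g b * integral {c..b} h\<bar> \<le> 1 * (2 / \<bar>real_of_int m\<bar>)"
      unfolding abs_mult using c ab by (intro mult_mono bound le) auto
    ultimately show ?thesis unfolding c(2) by linarith
  qed
  have "Re (integral {a..b} f) = integral {a..b} (Re \<circ> f)" "Im (integral {a..b} f) = integral {a..b} (Im \<circ> f)"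
    by (simp_all add: integral_linear[OF f bounded_linear_Re] integral_linear[OF f bounded_linear_Im])
  moreover have "Re \<circ> f = (\<lambda>t. g t * cos (of_int m * t))" "Im \<circ> f = (\<lambda>t. g t * (- sin (of_int m * t)))"
    by (auto simp: f_def)
  moreover have "\<bar>integral {a..b} (\<lambda>t. g t * cos (of_int m * t))\<bar> \<le> 4 / \<bar>real_of_int m\<bar>"
  proof (rule part)
    show "((\<lambda>t. sin (of_int m * t) / of_int m) has_field_derivative cos (of_int m * x)) (at x)" for x
      using m by (auto intro!: derivative_eq_intros)
  qed (simp add: divide_right_mono)
  moreover have "\<bar>integral {a..b} (\<lambda>t. g t * (- sin (of_int m * t)))\<bar> \<le> 4 / \<bar>real_of_int m\<bar>"
  proof (rule part)
    show "((\<lambda>t. cos (of_int m * t) / of_int m) has_field_derivative - sin (of_int m * x)) (at x)" for x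
      using m by (auto intro!: derivative_eq_intros)
  qed (simp add: divide_right_mono)
  ultimately have "\<bar>Re (integral {a..b} f)\<bar> + \<bar>Im (integral {a..b} f)\<bar> \<le> 8 / \<bar>real_of_int m\<bar>"
    by simp
  with cmod_le[of "integral {a..b} f"] show ?thesis unfolding f_def by linarith
qed

text \<open>\<open>kernel_ratio\<close> decreases from 1 to 0 on the first half of the interval and
  from 0 to -1 on the second. Its powers need not be monotone on the whole interval, but after a
  change of sign they increase on each half and stay within \<open>{-1..1}\<close>. Each half
  contributes 8, whatever \<open>n\<close> is.\<close>

lemma norm_kernel_integral_le_inverse:
  assumes m: "m \<noteq> 0"
  shows "norm (kernel_integral m n) \<le> 16 / \<bar>real_of_int m\<bar>"
proof -
  let ?e = "\<lambda>t. cis (- of_int m * t)"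
  have cont: "continuous_on {0..pi / 2} kernel_ratio" "continuous_on {pi / 2..pi} kernel_ratio"
    by (rule continuous_on_subset[OF continuous_on_kernel_ratio]; auto)+
  have split: "kernel_integral m n = integral {0..pi / 2} (\<lambda>t. ?e t * of_real (kernel_ratio t ^ n)) +
      integral {pi / 2..pi} (\<lambda>t. ?e t * of_real (kernel_ratio t ^ n))"
    unfolding kernel_integral_def
    by (rule Henstock_Kurzweil_Integration.integral_combine[symmetric])
       (use integrable_continuous_real[OF kernel_integrand_continuous[of m n]] in auto)
  have "norm (integral {0..pi / 2} (\<lambda>t. ?e t * of_real (- (kernel_ratio t ^ n)))) \<le> 8 / \<bar>real_of_int m\<bar>"
  proof (rule norm_le_of_monotone_oscillation)
    fix x y assume xy: "0 \<le> x" "x \<le> y" "y \<le> pi / 2"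
    have "kernel_ratio y \<le> kernel_ratio x"
      unfolding kernel_ratio_def
    proof (rule frac_le)
      show "cos x \<ge> 0" using xy by (intro cos_ge_zero) auto
      show "cos y \<le> cos x" using xy by (intro cos_monotone_0_pi_le) auto
      show "1 + sin x \<le> 1 + sin y" using xy by (simp add: sin_mono_le_eq)
      show "0 < 1 + sin x" using xy sin_ge_zero[of x] by auto
    qed
    moreover have "0 \<le> kernel_ratio y"
      unfolding kernel_ratio_def using xy sin_ge_zero[of y] cos_ge_zero[of y] by auto
    ultimately show "- (kernel_ratio x ^ n) \<le> - (kernel_ratio y ^ n)"
      by (simp add: power_mono)
  next
    show "\<bar>- (kernel_ratio x ^ n)\<bar> \<le> 1" if "0 \<le> x" "x \<le> pi / 2" for x
      using abs_kernel_ratio_le_one[of x] that by (simp add: power_abs power_le_one)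
  qed (auto intro!: continuous_intros cont m)
  moreover have "norm (integral {pi / 2..pi} (\<lambda>t. ?e t * of_real ((- kernel_ratio t) ^ n))) \<le> 8 / \<bar>real_of_int m\<bar>"
  proof (rule norm_le_of_monotone_oscillation)
    fix x y assume xy: "pi / 2 \<le> x" "x \<le> y" "y \<le> pi"
    have cos: "cos x \<le> 0" using xy cos_ge_zero[of "pi - x"] by (simp add: cos_diff)
    have sin: "0 \<le> sin x" "0 \<le> sin y" using xy by (auto intro!: sin_ge_zero)
    have "(- cos x) / (1 + sin x) \<le> (- cos y) / (1 + sin y)"
    proof (rule frac_le)
      have c: "cos y \<le> cos x" using xy by (intro cos_monotone_0_pi_le) auto
      then show "- cos x \<le> - cos y" by simp
      show "0 \<le> - cos y" using cos c by linarith
      have "sin (pi - y) \<le> sin (pi - x)" using xy by (subst sin_mono_le_eq) auto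
      then show "1 + sin y \<le> 1 + sin x" by (simp add: sin_diff)
    qed (use sin in linarith)
    moreover have "0 \<le> - kernel_ratio x"
      unfolding kernel_ratio_def using cos sin by (simp add: divide_nonpos_pos)
    ultimately show "(- kernel_ratio x) ^ n \<le> (- kernel_ratio y) ^ n"
      by (intro power_mono) (auto simp: kernel_ratio_def)
  next
    show "\<bar>(- kernel_ratio x) ^ n\<bar> \<le> 1" if "pi / 2 \<le> x" "x \<le> pi" for x
    proof -
      have "0 \<le> x" using that(1) pi_gt_zero by linarith
      then show ?thesis using abs_kernel_ratio_le_one[of x] that by (simp add: power_abs power_le_one)
    qed
  qed (auto intro!: continuous_intros cont m)
  moreover have "integral {pi / 2..pi} (\<lambda>t. ?e t * of_real ((- kernel_ratio t) ^ n)) =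
      (- 1) ^ n * integral {pi / 2..pi} (\<lambda>t. ?e t * of_real (kernel_ratio t ^ n))"
  proof -
    have "?e t * of_real ((- kernel_ratio t) ^ n) = (- 1) ^ n * (?e t * of_real (kernel_ratio t ^ n))" for t
      unfolding power_minus[of "kernel_ratio t"] by simp
    then show ?thesis by (simp only: integral_mult_right)
  qed
  ultimately show ?thesis
    unfolding split by (intro norm_triangle_le) (simp add: norm_mult norm_power)
qed

text \<open>The integral of \<open>\<bar>kernel_ratio t\<bar> ^ n\<close> bounds the norm for every
  \<open>m\<close>. It tends to 0 by dominated convergence, since the modulus of the ratio is below
  1 except at the two endpoints.\<close>

lemma kernel_integral_uniform_decay:
  obtains e where "e \<longlonglongrightarrow> (0::real)" "\<And>m n. norm (kernel_integral m n) \<le> e n"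
proof -
  define e where "e = (\<lambda>n. integral {0..pi} (\<lambda>t. \<bar>kernel_ratio t\<bar> ^ n))"
  define g where "g = (\<lambda>t. if t \<in> {0, pi} then 1 else 0 :: real)"
  have int: "(\<lambda>t. \<bar>kernel_ratio t\<bar> ^ n) integrable_on {0..pi}" for n
    by (intro integrable_continuous_real continuous_intros continuous_on_kernel_ratio)
  have "(\<lambda>n. integral {0..pi} (\<lambda>t. \<bar>kernel_ratio t\<bar> ^ n)) \<longlonglongrightarrow> integral {0..pi} g"
  proof (rule dominated_convergence)
    show "(\<lambda>t. 1::real) integrable_on {0..pi}" by (rule integrable_const_ivl)
    show "norm (\<bar>kernel_ratio t\<bar> ^ n) \<le> 1" if "t \<in> {0..pi}" for n t
      using abs_kernel_ratio_le_one[of t] that by (simp add: power_le_one)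
    show "(\<lambda>n. \<bar>kernel_ratio t\<bar> ^ n) \<longlonglongrightarrow> g t" if t: "t \<in> {0..pi}" for t
    proof (cases "t \<in> {0, pi}")
      case False
      with t have "sin t > 0" by (intro sin_gt_zero) auto
      moreover from this have "\<bar>cos t\<bar> < 1 + sin t" using abs_cos_le_one[of t] by linarith
      ultimately have "\<bar>kernel_ratio t\<bar> < 1" by (simp add: kernel_ratio_def)
      with False show ?thesis by (simp add: g_def LIMSEQ_power_zero)
    qed (auto simp: g_def kernel_ratio_def)
  qed (rule int)
  moreover have "integral {0..pi} g = integral {0..pi} (\<lambda>_. 0)"
    by (rule integral_spike[of "{0, pi}"]) (auto simp: g_def)
  ultimately have "e \<longlonglongrightarrow> 0" by (simp add: e_def)
  moreover have "norm (kernel_integral m n) \<le> e n" for m n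
    unfolding kernel_integral_def e_def
    by (rule integral_norm_bound_integral[OF integrable_continuous_real[OF kernel_integrand_continuous] int])
       (simp add: norm_mult norm_power)
  ultimately show ?thesis using that by blast
qed

section \<open>Reduction of the Cauchy kernel to the oscillatory integral\<close>

text \<open>The two values of \<open>q\<close> enter with the exponentials
  \<open>cis (- m * x)\<close> and \<open>\<i> * cis ((1 - m) * x)\<close>, whose sum has the factor
  \<open>1 + \<i> * cis x\<close>.\<close>

lemma cauchy_kernel_eq_iterated:
  "cauchy_kernel (m, n) = of_real (1 / (2 * pi)\<^sup>2) * (\<integral>x. indicator {0..2 * pi} x *\<^sub>R
      (cis (- of_int m * x) * ((1 + \<i> * cis x) * inner_integral (- n) x)) \<partial>lborel)"
  and cauchy_kernel_integrand_integrable: "integrable lborel (\<lambda>x. indicator {0..2 * pi} x *\<^sub>R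
      (cis (- of_int m * x) * ((1 + \<i> * cis x) * inner_integral (- n) x)))"
proof -
  define G where "G = (\<lambda>m n x. indicator {0..2 * pi} x *\<^sub>R (cis (of_int m * x) * inner_integral n x))"
  have G: "integrable lborel (G m n)" and q: "q (m, n) = of_real (1 / (2 * pi)\<^sup>2) * (\<integral>x. G m n x \<partial>lborel)" for m n
    unfolding G_def by (fact q_eq_iterated)+
  have cis: "cis (of_int (1 - m) * x) = cis (- of_int m * x) * cis x" for x
    by (simp add: cis_mult algebra_simps)
  have sum: "(\<lambda>x. G (- m) (- n) x + \<i> * G (1 - m) (- n) x) = (\<lambda>x. indicator {0..2 * pi} x *\<^sub>R
      (cis (- of_int m * x) * ((1 + \<i> * cis x) * inner_integral (- n) x)))"
    unfolding G_def cis by (auto simp: algebra_simps)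
  have "cauchy_kernel (m, n) = of_real (1 / (2 * pi)\<^sup>2) * (\<integral>x. G (- m) (- n) x + \<i> * G (1 - m) (- n) x \<partial>lborel)"
    unfolding cauchy_kernel_def uminus_Pair diff_Pair diff_0 q
    by (simp only: G Bochner_Integration.integral_add
        integral_mult_right_zero integrable_mult_right ring_distribs mult.left_commute[of \<i>])
  then show "cauchy_kernel (m, n) = of_real (1 / (2 * pi)\<^sup>2) * (\<integral>x. indicator {0..2 * pi} x *\<^sub>R
      (cis (- of_int m * x) * ((1 + \<i> * cis x) * inner_integral (- n) x)) \<partial>lborel)"
    unfolding sum .
  show "integrable lborel (\<lambda>x. indicator {0..2 * pi} x *\<^sub>R
      (cis (- of_int m * x) * ((1 + \<i> * cis x) * inner_integral (- n) x)))"
    unfolding sum[symmetric] by (intro Bochner_Integration.integrable_add integrable_mult_right G)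
qed

text \<open>By the closed form the integrand lives on the half-period where \<open>sin\<close> is
  positive if \<open>n < 0\<close>, and on the other one if \<open>n \<ge> 0\<close>.\<close>

lemma norm_cauchy_kernel:
  "norm (cauchy_kernel (m, n)) = norm (kernel_integral m (nat \<bar>n\<bar>)) / (2 * pi)"
proof -
  \<comment> \<open>Common to both signs of \<open>n\<close>: \<open>S\<close> is the half-period
    that carries the integrand and \<open>c\<close> is its sign.\<close>
  have *: "cauchy_kernel (m, n) = c / (2 * pi) * integral S (\<lambda>x. cis (- of_int m * x) * of_real (f x))"
    if f: "continuous_on S f" and S: "S = {a..b}"
      and eq: "\<And>x. x \<in> {0..2 * pi} \<Longrightarrow> sin x \<noteq> 0 \<Longrightarrow> cos x \<noteq> 0 \<Longrightarrow>
          (1 + \<i> * cis x) * inner_integral (- n) x = (if x \<in> S then 2 * pi * c * f x else 0)"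
      and sub: "S \<subseteq> {0..2 * pi}"
    for S a b f and c :: real
  proof -
    have int: "set_integrable lborel S (\<lambda>x. cis (- of_int m * x) * of_real (f x))"
      using f unfolding S by (intro borel_integrable_atLeastAtMost' continuous_intros)
    have "cauchy_kernel (m, n) = of_real (1 / (2 * pi)\<^sup>2) *
        (\<integral>x. (2 * pi * c) * (indicator S x *\<^sub>R (cis (- of_int m * x) * of_real (f x))) \<partial>lborel)"
      unfolding cauchy_kernel_eq_iterated
    proof (intro arg_cong2[of _ _ _ _ "(*)"] refl integral_cong_AE)
      show "AE x in lborel. indicator {0..2 * pi} x *\<^sub>R
          (cis (- of_int m * x) * ((1 + \<i> * cis x) * inner_integral (- n) x)) =
          (2 * pi * c) * (indicator S x *\<^sub>R (cis (- of_int m * x) * of_real (f x)))"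
        using AE_sin_cos_nonzero
      proof eventually_elim
        case (elim x)
        show ?case
        proof (cases "x \<in> {0..2 * pi}")
          case True
          with elim eq[of x] show ?thesis by (simp split: split_indicator)
        next
          case False
          moreover from this sub have "x \<notin> S" by blast
          ultimately show ?thesis by simp
        qed
      qed
      show "(\<lambda>x. (2 * pi * c) * (indicator S x *\<^sub>R (cis (- of_int m * x) * of_real (f x)))) \<in> borel_measurable lborel"
        by (intro borel_measurable_integrable integrable_mult_right int[unfolded set_integrable_def])
    qed (rule borel_measurable_integrable[OF cauchy_kernel_integrand_integrable])
    also have "\<dots> = of_real (1 / (2 * pi)\<^sup>2) * ((2 * pi * c) *
        (LINT x:S|lborel. cis (- of_int m * x) * of_real (f x)))"
      unfolding set_lebesgue_integral_def by (subst integral_mult_right_zero) (rule refl)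
    also have "(LINT x:S|lborel. cis (- of_int m * x) * of_real (f x)) =
        integral S (\<lambda>x. cis (- of_int m * x) * of_real (f x))"
      by (rule set_borel_integral_eq_integral(2)[OF int])
    finally show ?thesis by (simp add: power2_eq_square)
  qed
  have pos: "sin x > 0 \<longleftrightarrow> x \<in> {0..pi}" "sin x > 0 \<longleftrightarrow> x \<notin> {pi..2 * pi}"
    if "x \<in> {0..2 * pi}" "sin x \<noteq> 0" for x
  proof -
    have x: "x \<noteq> 0" "x \<noteq> pi" "x \<noteq> 2 * pi" "0 \<le> x" "x \<le> 2 * pi" using that by auto
    show "sin x > 0 \<longleftrightarrow> x \<in> {0..pi}" "sin x > 0 \<longleftrightarrow> x \<notin> {pi..2 * pi}"
      using x sin_gt_zero[of x] sin_lt_zero[of x] by (cases "x < pi"; simp)+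
  qed
  show ?thesis
  proof (cases "n < 0")
    case True
    have "cauchy_kernel (m, n) = (- 1) / (2 * pi) * kernel_integral m (nat \<bar>n\<bar>)"
      unfolding kernel_integral_def
    proof (rule *[of "{0..pi}" "\<lambda>t. kernel_ratio t ^ nat \<bar>n\<bar>" 0 pi "- 1"])
      fix x assume x: "x \<in> {0..2 * pi}" "sin x \<noteq> 0" "cos x \<noteq> 0"
      show "(1 + \<i> * cis x) * inner_integral (- n) x =
          (if x \<in> {0..pi} then 2 * pi * (- 1) * kernel_ratio x ^ nat \<bar>n\<bar> else 0)"
        unfolding inner_integral_closed_form[OF x(2,3)] pos(1)[OF x(1,2)] kernel_ratio_def
        using True by simp
    qed (auto intro!: continuous_intros continuous_on_kernel_ratio)
    then show ?thesis by (simp add: norm_mult norm_divide)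
  next
    case False
    define h :: "real \<Rightarrow> real" where "h = (\<lambda>x. (cos x / (1 - sin x)) ^ nat \<bar>n\<bar>)"
    have h: "continuous_on {pi..2 * pi} h"
      unfolding h_def
    proof (intro continuous_intros ballI)
      fix x assume x: "x \<in> {pi..2 * pi}"
      then have "sin x \<le> 0" by (cases "x = 2 * pi") (auto intro: sin_le_zero)
      then show "1 - sin x \<noteq> 0" by linarith
    qed
    have "cauchy_kernel (m, n) = 1 / (2 * pi) * integral {pi..2 * pi} (\<lambda>x. cis (- of_int m * x) * of_real (h x))"
    proof (rule *[OF h refl])
      fix x assume x: "x \<in> {0..2 * pi}" "sin x \<noteq> 0" "cos x \<noteq> 0"
      show "(1 + \<i> * cis x) * inner_integral (- n) x =
          (if x \<in> {pi..2 * pi} then 2 * pi * 1 * h x else 0)"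
        unfolding inner_integral_closed_form[OF x(2,3)] pos(2)[OF x(1,2)] h_def
        using False by simp
    qed simp
    \<comment> \<open>Shifting by \<open>pi\<close> changes the sign of both \<open>sin\<close> and
      \<open>cos\<close>. The ratio becomes \<open>- kernel_ratio\<close>, and only unimodular
      constants come out.\<close>
    also have "integral {pi..2 * pi} (\<lambda>x. cis (- of_int m * x) * of_real (h x)) =
        integral {0..pi} (\<lambda>x. cis (- of_int m * (x + pi)) * of_real (h (x + pi)))"
      using integral_shift_real_ivl[of pi pi "2 * pi" "\<lambda>x. cis (- of_int m * x) * of_real (h x)"] by simp
    also have "(\<lambda>x. cis (- of_int m * (x + pi)) * of_real (h (x + pi))) =
        (\<lambda>x. cis (- of_int m * pi) * (- 1) ^ nat \<bar>n\<bar> * (cis (- of_int m * x) * of_real (kernel_ratio x ^ nat \<bar>n\<bar>)))"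
    proof
      fix x
      have "h (x + pi) = (- 1) ^ nat \<bar>n\<bar> * kernel_ratio x ^ nat \<bar>n\<bar>"
        by (simp add: h_def kernel_ratio_def flip: power_mult_distrib)
      moreover have "cis (- of_int m * (x + pi)) = cis (- of_int m * pi) * cis (- of_int m * x)"
        by (simp add: cis_mult algebra_simps)
      ultimately show "cis (- of_int m * (x + pi)) * of_real (h (x + pi)) =
        cis (- of_int m * pi) * (- 1) ^ nat \<bar>n\<bar> * (cis (- of_int m * x) * of_real (kernel_ratio x ^ nat \<bar>n\<bar>))"
        by simp
    qed
    also have "integral {0..pi} \<dots> = cis (- of_int m * pi) * (- 1) ^ nat \<bar>n\<bar> * kernel_integral m (nat \<bar>n\<bar>)"
      unfolding kernel_integral_def by (rule integral_mult_right)
    finally show ?thesis by (simp add: norm_mult norm_divide norm_power)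
  qed
qed

lemma cauchy_kernel_bounds:
  "\<exists>K e. K > 0 \<and> e \<longlonglongrightarrow> (0::real) \<and>
    (\<forall>m n. norm (cauchy_kernel (m, n)) \<le> K / (1 + \<bar>real_of_int m\<bar>)) \<and>
    (\<forall>m n. norm (cauchy_kernel (m, n)) \<le> e (nat \<bar>n\<bar>))"
proof -
  obtain e where e: "e \<longlonglongrightarrow> (0::real)" "\<And>m n. norm (kernel_integral m n) \<le> e n"
    using kernel_integral_uniform_decay by blast
  obtain B where B: "\<And>n. \<bar>e n\<bar> \<le> B" "B > 0"
    using convergent_imp_Bseq[of e] e(1) by (auto simp: convergent_def Bseq_def)
  have le: "norm (cauchy_kernel (m, n)) \<le> norm (kernel_integral m (nat \<bar>n\<bar>))" for m n
    unfolding norm_cauchy_kernel using pi_ge_two by (simp add: divide_le_eq mult_le_cancel_left1)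
  \<comment> \<open>\<open>B\<close> covers \<open>m = 0\<close>, and 32 is twice 16 because
    \<open>1 + \<bar>m\<bar> \<le> 2 * \<bar>m\<bar>\<close> for all other \<open>m\<close>.\<close>
  have "norm (cauchy_kernel (m, n)) \<le> (B + 32) / (1 + \<bar>real_of_int m\<bar>)" for m n
  proof (cases "m = 0")
    case True
    then show ?thesis using le[of m n] e(2)[of m "nat \<bar>n\<bar>"] B(1)[of "nat \<bar>n\<bar>"] by simp
  next
    case False
    then have m: "\<bar>real_of_int m\<bar> \<ge> 1" by linarith
    have "norm (cauchy_kernel (m, n)) \<le> 16 / \<bar>real_of_int m\<bar>"
      using le norm_kernel_integral_le_inverse[OF False] by (rule order_trans)
    also have "\<dots> \<le> 32 / (1 + \<bar>real_of_int m\<bar>)" using m by (simp add: divide_simps)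
    also have "\<dots> \<le> (B + 32) / (1 + \<bar>real_of_int m\<bar>)" using B(2) by (intro divide_right_mono) auto
    finally show ?thesis .
  qed
  moreover have "norm (cauchy_kernel (m, n)) \<le> e (nat \<bar>n\<bar>)" for m n
    using le e(2) by (rule order_trans)
  ultimately show ?thesis using e(1) B(2) by (intro exI[of _ "B + 32"] exI[of _ e]) simp
qed

section \<open>Summability of the rows of \<open>f\<close> against the kernel\<close>

lemma summable_on_int_powr:
  fixes \<sigma> :: real
  assumes "\<sigma> > 1"
  shows "(\<lambda>k::int. (1 / (1 + \<bar>real_of_int k\<bar>)) powr \<sigma>) summable_on UNIV"
proof -
  let ?g = "\<lambda>k::int. (1 / (1 + \<bar>real_of_int k\<bar>)) powr \<sigma>"
  have "summable (\<lambda>n. real (Suc n) powr (- \<sigma>))"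
    using assms summable_Suc_iff[of "\<lambda>n. real n powr (- \<sigma>)"] by (simp only: summable_real_powr_iff)
  then have nat: "(\<lambda>n::nat. (1 / (1 + real n)) powr \<sigma>) summable_on UNIV"
    by (subst summable_on_UNIV_nonneg_real_iff) (auto simp: powr_divide powr_minus_divide)
  have "?g summable_on range int" "?g summable_on range (\<lambda>n. - int n)"
    using nat by (subst summable_on_reindex; simp add: inj_on_def o_def)+
  then have "?g summable_on range int \<union> (range (\<lambda>n. - int n) - range int)"
    by (rule summable_on_Un_disjoint[OF _ summable_on_subset_banach]) auto
  moreover have "range int \<union> (range (\<lambda>n. - int n) - range int) = UNIV"
  proof -
    have "k \<in> range int \<union> range (\<lambda>n. - int n)" for k :: int
      by (cases k rule: int_cases2) auto
    then show ?thesis by blast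
  qed
  ultimately show ?thesis by simp
qed

lemma bounded_sums_imp_summable_on:
  fixes g :: "'a \<Rightarrow> real"
  assumes "\<And>x. 0 \<le> g x" "\<And>A. finite A \<Longrightarrow> sum g A \<le> F"
  shows "g summable_on UNIV" "infsum g UNIV \<le> F"
proof -
  show "g summable_on UNIV"
    using assms by (intro nonneg_bdd_above_summable_on bdd_aboveI2[of _ _ F]) auto
  then show "infsum g UNIV \<le> F"
    using assms(2) by (rule infsum_le_finite_sums)
qed

text \<open>Young's inequality for \<open>t u\<close> and \<open>c / t\<close> with \<open>t = e\<^bsup>1 / (4 r)\<^esup>\<close>. The factor
  \<open>c\<^bsup>r / (r - 1)\<^esup>\<close> is split so that one part is controlled by the uniform bound \<open>e\<close> while the
  other still decays fast enough to be summable.\<close>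

lemma mult_summable_of_decay:
  fixes r K e F :: real and u c :: "int \<Rightarrow> real"
  assumes r: "r > 1" and K: "K > 0" and e: "e > 0"
    and u: "\<And>k. 0 \<le> u k" and c: "\<And>k. 0 \<le> c k"
    and F: "\<And>A. finite A \<Longrightarrow> (\<Sum>k\<in>A. u k powr r) \<le> F"
    and cK: "\<And>k. c k \<le> K / (1 + \<bar>real_of_int (a - k)\<bar>)" and ce: "\<And>k. c k \<le> e"
  defines "\<delta> \<equiv> 1 / (r - 1)"
  defines "w \<equiv> \<lambda>k::int. (K / (1 + \<bar>real_of_int k\<bar>)) powr (1 + \<delta> / 2)"
  shows "(\<lambda>k. u k * c k) summable_on UNIV"
    and "(\<Sum>\<^sub>\<infinity>k. u k * c k) \<le> e powr (1/4) * F + e powr (\<delta> / 4) * infsum w UNIV"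
proof -
  have \<delta>: "\<delta> > 0" using r by (simp add: \<delta>_def)
  \<comment> \<open>That is, \<open>1 + \<delta>\<close> is the exponent conjugate to
    \<open>r\<close>.\<close>
  have conj: "r * \<delta> = 1 + \<delta>" using r by (simp add: \<delta>_def field_simps)
  have "(\<lambda>k. K powr (1 + \<delta> / 2) * (1 / (1 + \<bar>real_of_int k\<bar>)) powr (1 + \<delta> / 2)) summable_on UNIV"
    using \<delta> by (intro summable_on_cmult_right summable_on_int_powr) simp
  then have w: "w summable_on UNIV"
    using K by (simp add: w_def powr_divide)
  note uF = bounded_sums_imp_summable_on[of "\<lambda>k. u k powr r", OF powr_ge_zero F]
  have bij: "bij_betw (\<lambda>k. a - k) UNIV (UNIV :: int set)"
    by (rule bij_betw_byWitness[of _ "\<lambda>k. a - k"]) auto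
  have wa: "(\<lambda>k. w (a - k)) summable_on UNIV" "(\<Sum>\<^sub>\<infinity>k. w (a - k)) = infsum w UNIV"
    using w summable_on_reindex_bij_betw[OF bij, of w] infsum_reindex_bij_betw[OF bij, of w] by auto
  \<comment> \<open>This choice makes \<open>t powr r\<close> equal to \<open>e powr (1/4)\<close>
    and \<open>t powr (1 + \<delta>)\<close> equal to \<open>e powr (\<delta> / 4)\<close>. The
    latter is only half of the gain \<open>e powr (\<delta> / 2)\<close> won from \<open>c\<close>,
    so both terms keep a positive power of \<open>e\<close>.\<close>
  define t where "t = e powr (1 / (4 * r))"
  have t: "t > 0" using e by (simp add: t_def)
  have young: "u k * c k \<le> e powr (1/4) * u k powr r + e powr (\<delta> / 4) * w (a - k)" for k
  proof -
    have "u k * c k = (t * u k) * (c k / t)" using t by simp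
    also have "\<dots> \<le> (t * u k) powr r / r + (c k / t) powr (1 + \<delta>) / (1 + \<delta>)"
    proof (rule Youngs_inequality)
      have "1 / (1 + \<delta>) = 1 - 1 / r" using r by (simp add: \<delta>_def field_simps)
      then show "1 / r + 1 / (1 + \<delta>) = 1" by simp
    qed (use r \<delta> t u c in auto)
    also have "\<dots> \<le> (t * u k) powr r + (c k / t) powr (1 + \<delta>)"
      using r \<delta> by (intro add_mono) (auto simp: divide_le_eq mult_le_cancel_left1)
    also have "(t * u k) powr r = e powr (1/4) * u k powr r"
      using t u r by (simp add: powr_mult t_def powr_powr)
    also have "(c k / t) powr (1 + \<delta>) = c k powr (1 + \<delta>) / t powr (1 + \<delta>)"
      using t c by (simp add: powr_divide)
    also have "t powr (1 + \<delta>) = e powr (\<delta> / 4)"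
      using r unfolding conj[symmetric] by (simp add: t_def powr_powr)
    also have "c k powr (1 + \<delta>) = c k powr (\<delta> / 2) * c k powr (1 + \<delta> / 2)"
      by (simp add: add.commute flip: powr_add)
    also have "\<dots> \<le> e powr (\<delta> / 2) * w (a - k)"
      unfolding w_def using \<delta> c ce cK by (intro mult_mono powr_mono2) auto
    also have "e powr (\<delta> / 2) = e powr (\<delta> / 4) * e powr (\<delta> / 4)"
      by (simp flip: powr_add)
    finally show ?thesis using e by (simp add: divide_right_mono mult.assoc)
  qed
  have sum: "(\<lambda>k. e powr (1/4) * u k powr r + e powr (\<delta> / 4) * w (a - k)) summable_on UNIV"
    by (intro summable_on_add summable_on_cmult_right uF wa)
  show *: "(\<lambda>k. u k * c k) summable_on UNIV"
    by (rule summable_on_comparison_test[OF sum]) (use young u c in auto)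
  have "(\<Sum>\<^sub>\<infinity>k. u k * c k) \<le> (\<Sum>\<^sub>\<infinity>k. e powr (1/4) * u k powr r + e powr (\<delta> / 4) * w (a - k))"
    by (rule infsum_mono[OF * sum]) (rule young)
  also have "\<dots> = e powr (1/4) * (\<Sum>\<^sub>\<infinity>k. u k powr r) + e powr (\<delta> / 4) * infsum w UNIV"
    by (subst infsum_add) (auto intro!: summable_on_cmult_right uF wa simp: infsum_cmult_right' wa)
  also have "\<dots> \<le> e powr (1/4) * F + e powr (\<delta> / 4) * infsum w UNIV"
    using uF(2) by (intro add_right_mono mult_left_mono) auto
  finally show "(\<Sum>\<^sub>\<infinity>k. u k * c k) \<le> e powr (1/4) * F + e powr (\<delta> / 4) * infsum w UNIV" .
qed

text \<open>Translates the finiteness of the \<open>ennreal\<close>-valued norm into a real bound on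
  finite sums, uniform over the rows.\<close>

lemma Hp_rows_bounded:
  assumes "1 \<le> p" "p < \<infinity>" "f \<in> Hp p"
  obtains F where "\<And>n A. n \<ge> 0 \<Longrightarrow> finite A \<Longrightarrow> (\<Sum>m\<in>A. norm (f (m, n)) powr enn2real p) \<le> F"
proof -
  define P where "P = enn2real p"
  have P: "P \<ge> 1"
    using assms(1,2) unfolding P_def by (metis enn2real_1 enn2real_mono infinity_ennreal_def)
  have "p \<noteq> \<infinity>" using assms(2) by auto
  define B where "B = Hp_norm p f"
  have B: "B < \<infinity>" using assms(3) by (simp add: Hp_def B_def)
  have "(\<Sum>m\<in>A. norm (f (m, n)) powr P) \<le> enn2real B powr P" if n: "n \<ge> 0" and A: "finite A" for n A
  proof -
    define S where "S = (\<Sum>\<^sub>\<infinity>k. ennreal (norm (f (k, n)) powr P))"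
    have "lp_norm p (\<lambda>m. f (m, n)) \<le> B"
      unfolding B_def Hp_norm_def using n by (intro SUP_upper) simp
    then have le: "(if S = \<infinity> then \<infinity> else ennreal (enn2real S powr (1 / P))) \<le> B"
      using \<open>p \<noteq> \<infinity>\<close> by (simp only: lp_norm_def S_def P_def Let_def if_False)
    \<comment> \<open>As \<open>enn2real\<close> sends infinity to 0, comparing real values is
      meaningful only once \<open>S\<close> is known to be finite.\<close>
    then have S: "S < \<infinity>" using B by (auto simp: top.not_eq_extremum split: if_splits)
    then have "S \<noteq> \<infinity>" by auto
    with le have "ennreal (enn2real S powr (1 / P)) \<le> B" by simp
    then have "enn2real S powr (1 / P) \<le> enn2real B"
      using B enn2real_mono[of "ennreal (enn2real S powr (1 / P))" B] by simp
    then have "(enn2real S powr (1 / P)) powr P \<le> enn2real B powr P"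
      using P by (intro powr_mono2) auto
    then have SB: "enn2real S \<le> enn2real B powr P"
      using P by (simp add: powr_powr)
    have "ennreal (\<Sum>m\<in>A. norm (f (m, n)) powr P) = (\<Sum>m\<in>A. ennreal (norm (f (m, n)) powr P))"
      by (simp add: sum_ennreal)
    also have "\<dots> \<le> S"
      unfolding S_def using A by (subst nonneg_infsum_complete) (auto intro!: SUP_upper)
    finally have "(\<Sum>m\<in>A. norm (f (m, n)) powr P) \<le> enn2real S"
      using S enn2real_mono[of "ennreal (\<Sum>m\<in>A. norm (f (m, n)) powr P)" S] by (simp add: sum_nonneg)
    with SB show ?thesis by linarith
  qed
  then show ?thesis using that unfolding P_def by blast
qed

text \<open>For \<open>p = 1\<close> there is no finite conjugate exponent for Young's inequality.
  Single terms of the sums bound \<open>f\<close> uniformly, so one more power of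
  \<open>norm (f (m, n))\<close> costs only a constant, and \<open>r = P + 1\<close> serves every
  \<open>p\<close> at once.\<close>

lemma Hp_rows_bounded_exponent_gt_one:
  assumes "1 \<le> p" "p < \<infinity>" "f \<in> Hp p"
  shows "\<exists>r F. r > 1 \<and> (\<forall>n\<ge>0. \<forall>A. finite A \<longrightarrow> (\<Sum>m\<in>A. norm (f (m, n)) powr r) \<le> F)"
proof -
  define P where "P = enn2real p"
  have P: "P \<ge> 1"
    using assms(1,2) unfolding P_def by (metis enn2real_1 enn2real_mono infinity_ennreal_def)
  obtain F where F: "\<And>n A. n \<ge> 0 \<Longrightarrow> finite A \<Longrightarrow> (\<Sum>m\<in>A. norm (f (m, n)) powr P) \<le> F"
    using Hp_rows_bounded[OF assms] unfolding P_def by blast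
  have "norm (f (m, n)) \<le> F powr (1 / P)" if "n \<ge> 0" for m n
  proof -
    have "(norm (f (m, n)) powr P) powr (1 / P) \<le> F powr (1 / P)"
      using F[OF that, of "{m}"] P by (intro powr_mono2) auto
    then show ?thesis using P by (simp add: powr_powr)
  qed
  then have "(\<Sum>m\<in>A. norm (f (m, n)) powr (P + 1)) \<le> F powr (1 / P) * F" if "n \<ge> 0" "finite A" for n A
  proof -
    have "(\<Sum>m\<in>A. norm (f (m, n)) powr (P + 1)) \<le> (\<Sum>m\<in>A. F powr (1 / P) * norm (f (m, n)) powr P)"
    proof (rule sum_mono)
      fix m
      have "norm (f (m, n)) powr (P + 1) = norm (f (m, n)) * norm (f (m, n)) powr P"
        by (simp add: powr_add)
      also have "\<dots> \<le> F powr (1 / P) * norm (f (m, n)) powr P"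
        using \<open>\<And>n m. n \<ge> 0 \<Longrightarrow> norm (f (m, n)) \<le> F powr (1 / P)\<close> that by (intro mult_right_mono) auto
      finally show "norm (f (m, n)) powr (P + 1) \<le> F powr (1 / P) * norm (f (m, n)) powr P" .
    qed
    also have "\<dots> = F powr (1 / P) * (\<Sum>m\<in>A. norm (f (m, n)) powr P)"
      by (simp add: sum_distrib_left)
    also have "\<dots> \<le> F powr (1 / P) * F"
      using F that by (intro mult_left_mono) auto
    finally show ?thesis .
  qed
  then show ?thesis using P by (intro exI[of _ "P + 1"] exI[of _ "F powr (1 / P) * F"]) simp
qed

section \<open>Telescoping along rows and the discrete Green identity\<close>

text \<open>An injective \<open>h\<close> turns the sum over the integers into a convergent series.
  Both ends of a row are covered in this way.\<close>

lemma tendsto_zero_of_powr_summable_on: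
  fixes g :: "int \<Rightarrow> 'a::real_normed_vector" and h :: "nat \<Rightarrow> int"
  assumes "(\<lambda>m. norm (g m) powr r) summable_on UNIV" "inj h" "r > 0"
  shows "(\<lambda>n. g (h n)) \<longlonglongrightarrow> 0"
proof -
  have "(\<lambda>m. norm (g m) powr r) summable_on range h"
    by (rule summable_on_subset_banach[OF assms(1)]) simp
  then have "(\<lambda>n. norm (g (h n)) powr r) summable_on UNIV"
    using assms(2) by (simp add: summable_on_reindex o_def)
  then have "(\<lambda>n. norm (g (h n)) powr r) \<longlonglongrightarrow> 0"
    by (intro summable_LIMSEQ_zero summable_on_imp_summable)
  then have "(\<lambda>n. (norm (g (h n)) powr r) powr (1 / r)) \<longlonglongrightarrow> 0 powr (1 / r)"
    using assms(3) by (intro tendsto_powr2) auto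
  then show ?thesis using assms(3) by (simp add: powr_powr tendsto_norm_zero_iff)
qed

text \<open>The windows \<open>{- n..<n}\<close> exhaust the integers, so the sums over them tend to
  \<open>s\<close>. They telescope to \<open>U (- n) - U n\<close>, which tends to 0.\<close>

lemma has_sum_telescoping_int:
  fixes A U :: "int \<Rightarrow> 'a::{t2_space, real_normed_vector}"
  assumes sum: "(A has_sum s) UNIV" and A: "\<And>m. A m = U m - U (m + 1)"
    and U: "\<And>h :: nat \<Rightarrow> int. inj h \<Longrightarrow> (\<lambda>n. U (h n)) \<longlonglongrightarrow> 0"
  shows "s = 0"
proof -
  have "filterlim (\<lambda>n. {- int n..<int n}) (finite_subsets_at_top UNIV) sequentially"
    unfolding filterlim_finite_subsets_at_top
  proof (intro allI impI)
    fix X :: "int set" assume X: "finite X \<and> X \<subseteq> UNIV"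
    then obtain k where k: "\<And>x. x \<in> X \<Longrightarrow> \<bar>x\<bar> \<le> k"
      using finite_imageI[of X abs] by (auto simp: finite_int_iff_bounded_le)
    show "\<forall>\<^sub>F n in sequentially. finite {- int n..<int n} \<and> X \<subseteq> {- int n..<int n} \<and> {- int n..<int n} \<subseteq> UNIV"
      using eventually_gt_at_top[of "nat k"]
    proof eventually_elim
      case (elim n)
      have "x \<in> {- int n..<int n}" if "x \<in> X" for x
        using k[OF that] elim by auto
      then show ?case by auto
    qed
  qed
  then have lim: "(\<lambda>n. sum A {- int n..<int n}) \<longlonglongrightarrow> s"
    using sum unfolding has_sum_def by (rule filterlim_compose[rotated])
  have "sum A {- int n..<int n} = U (- int n) - U (int n)" for n
  proof (induction n)
    case (Suc n)
    have "{- int (Suc n)..<int (Suc n)} = insert (- int (Suc n)) (insert (int n) {- int n..<int n})"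
      by auto
    then have "sum A {- int (Suc n)..<int (Suc n)} = A (- int (Suc n)) + (A (int n) + sum A {- int n..<int n})"
      by (simp del: of_nat_Suc)
    moreover have "A (- int (Suc n)) = U (- int (Suc n)) - U (- int n)"
      using A[of "- int (Suc n)"] by simp
    moreover have "A (int n) = U (int n) - U (int (Suc n))"
      using A[of "int n"] by (simp add: add.commute)
    ultimately show ?case using Suc by (simp del: of_nat_Suc)
  qed simp
  moreover have "(\<lambda>n. U (- int n) - U (int n)) \<longlonglongrightarrow> 0 - 0"
    by (intro tendsto_diff U) (auto simp: inj_on_def)
  ultimately show "s = 0"
    using lim LIMSEQ_unique by fastforce
qed

text \<open>The equation for \<open>q\<close>, multiplied by \<open>f (m, n)\<close>, yields the
  point mass, and the equation for \<open>f\<close> turns the remainder into a difference in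
  \<open>m\<close>. \<open>U m\<close> is the flux through column \<open>m\<close> between the rows
  \<open>n\<close> and \<open>n + 1\<close>.\<close>

lemma discrete_Green_identity:
  fixes f :: "lattice \<Rightarrow> complex" and z0 :: lattice
  assumes f: "f \<in> Hol" and n: "n \<ge> 0"
  defines "U \<equiv> \<lambda>m. q ((m, n + 1) - z0) * (\<i> * f (m, n) - f (m, n + 1))"
  shows "f (m, n) * cauchy_kernel (z0 - (m, n)) - (if (m, n) = z0 then f z0 else 0) -
     f (m, n + 1) * cauchy_kernel (z0 - (m, n + 1)) = U m - U (m + 1)"
proof -
  obtain a b where z0: "z0 = (a, b)" by (cases z0)
  define q00 q10 q01 q11 where "q00 = q (m - a, n - b)" "q10 = q (m - a + 1, n - b)"
    "q01 = q (m - a, n - b + 1)" "q11 = q (m - a + 1, n - b + 1)"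
  note q_defs = this
  define f00 f10 f01 f11 where "f00 = f (m, n)" "f10 = f (m + 1, n)"
    "f01 = f (m, n + 1)" "f11 = f (m + 1, n + 1)"
  note f_defs = this
  have hol: "f00 + \<i> * f10 - f11 - \<i> * f01 = 0"
    using f n unfolding Hol_def upper_lattice_def f_defs by force
  have qd: "q00 + \<i> * q10 - \<i> * q01 - q11 = of_bool ((m, n) = z0)"
    using q_discrete_cauchy_riemann[of "m - a" "n - b"] by (simp add: q_defs z0)
  have C: "cauchy_kernel (z0 - (m, n)) = q00 + \<i> * q10" "cauchy_kernel (z0 - (m, n + 1)) = q01 + \<i> * q11"
    by (simp_all add: cauchy_kernel_def z0 q_defs algebra_simps)
  have U: "U m = q01 * (\<i> * f00 - f01)" "U (m + 1) = q11 * (\<i> * f10 - f11)"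
    by (simp_all add: U_def z0 q_defs f_defs algebra_simps)
  have "(if (m, n) = z0 then f z0 else 0) = f00 * (q00 + \<i> * q10 - \<i> * q01 - q11)"
    unfolding qd by (auto simp: f_defs)
  then have "f (m, n) * cauchy_kernel (z0 - (m, n)) - (if (m, n) = z0 then f z0 else 0) -
     f (m, n + 1) * cauchy_kernel (z0 - (m, n + 1)) = f00 * (\<i> * q01 + q11) - f01 * (q01 + \<i> * q11)"
    unfolding C f_defs(1,3)[symmetric] by (simp only:) (simp add: algebra_simps)
  also have "\<dots> = q01 * (\<i> * f00 - f01) + q11 * (f00 - \<i> * f01)"
    by (simp add: algebra_simps)
  \<comment> \<open>Here the discrete holomorphy of \<open>f\<close> enters.\<close>
  also have "f00 - \<i> * f01 = f11 - \<i> * f10"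
    using hol by (simp add: algebra_simps)
  finally show ?thesis unfolding U by (simp add: algebra_simps)
qed

section \<open>Constancy of the row sums and their limit\<close>

theorem proposition3p2:
  fixes p :: ennreal and f :: "lattice \<Rightarrow> complex" and z0 :: lattice
  assumes "1 \<le> p" and "p < \<infinity>"
    and "f \<in> Hp p"
  shows "(snd z0 \<ge> 0 \<longrightarrow>
            ((\<lambda>j::int. f (j, 0) * cauchy_kernel (z0 - (j, 0))) has_sum f z0) UNIV) \<and>
         (snd z0 < 0 \<longrightarrow>
            ((\<lambda>j::int. f (j, 0) * cauchy_kernel (z0 - (j, 0))) has_sum 0) UNIV)"
proof -
  obtain a b where z0: "z0 = (a, b)" by (cases z0)
  obtain r F where r: "r > 1"
    and F: "\<And>n A. n \<ge> 0 \<Longrightarrow> finite A \<Longrightarrow> (\<Sum>m\<in>A. norm (f (m, n)) powr r) \<le> F"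
    using Hp_rows_bounded_exponent_gt_one[OF assms] by auto
  obtain K e where K: "K > 0" and e: "e \<longlonglongrightarrow> (0::real)"
    and CK: "\<And>m n. norm (cauchy_kernel (m, n)) \<le> K / (1 + \<bar>real_of_int m\<bar>)"
    and Ce: "\<And>m n. norm (cauchy_kernel (m, n)) \<le> e (nat \<bar>n\<bar>)"
    using cauchy_kernel_bounds by auto
  \<comment> \<open>\<open>d\<close> and \<open>W\<close> are the quantities
    \<open>\<delta> / 4\<close> and \<open>infsum w UNIV\<close> from
    \<open>mult_summable_of_decay\<close>.\<close>
  define d where "d = 1 / (r - 1) / 4"
  have d: "d > 0" using r by (simp add: d_def)
  define W where "W = (\<Sum>\<^sub>\<infinity>k::int. (K / (1 + \<bar>real_of_int k\<bar>)) powr (1 + 1 / (r - 1) / 2))"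
  define g where "g = (\<lambda>n m. f (m, n) * cauchy_kernel (z0 - (m, n)))"
  define S where "S = (\<lambda>n. infsum (g n) UNIV)"
  have norm_g: "norm (g n m) = norm (f (m, n)) * norm (cauchy_kernel (a - m, b - n))" for n m
    by (simp add: g_def z0 norm_mult)
  \<comment> \<open>The second summand makes \<open>E n\<close> strictly positive, as the Young-type
    estimate requires, and still tends to 0.\<close>
  define E where "E = (\<lambda>n. \<bar>e (nat \<bar>b - n\<bar>)\<bar> + 1 / (1 + \<bar>real_of_int n\<bar>))"
  have row: "(\<lambda>m. norm (g n m)) summable_on UNIV \<and>
      (\<Sum>\<^sub>\<infinity>m. norm (g n m)) \<le> E n powr (1/4) * F + E n powr d * W" if "n \<ge> 0" for n
  proof -
    have CE: "norm (cauchy_kernel (a - m, b - n)) \<le> E n" for m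
      using Ce[of "a - m" "b - n"] by (simp add: E_def add_increasing2)
    have E: "0 < E n" by (simp add: E_def add_nonneg_pos)
    show ?thesis
      unfolding norm_g d_def W_def
      by (intro conjI mult_summable_of_decay[OF r K E norm_ge_zero norm_ge_zero F[OF that] CK CE])
  qed
  then have S_bound: "norm (S n) \<le> E n powr (1/4) * F + E n powr d * W" if "n \<ge> 0" for n
    unfolding S_def using that norm_infsum_bound[of "g n" UNIV] by (meson order_trans)
  have S: "(g n has_sum S n) UNIV" if "n \<ge> 0" for n
    unfolding S_def using row[OF that] by (blast intro: has_sum_infsum abs_summable_summable)
  obtain B where B: "\<And>z. norm (q z) \<le> B" using q_bounded by blast
  \<comment> \<open>Green's identity summed along row \<open>n\<close>: the point mass contributes
    \<open>f z0\<close> exactly when \<open>n = b\<close>, and the flux differences add up to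
    0.\<close>
  have step: "S n - (if n = b then f z0 else 0) - S (n + 1) = 0" if n: "n \<ge> 0" for n
  proof (rule has_sum_telescoping_int)
    have "((\<lambda>m. if (m, n) = z0 then f z0 else 0) has_sum (if n = b then f z0 else 0)) UNIV"
      by (rule has_sum_finite_neutralI[of "{a}"]) (auto simp: z0)
    then have "((\<lambda>m. g n m + - (if (m, n) = z0 then f z0 else 0) + - g (n + 1) m) has_sum
        (S n + - (if n = b then f z0 else 0) + - S (n + 1))) UNIV"
      using n by (intro has_sum_add has_sum_uminusI S) auto
    then show "((\<lambda>m. g n m - (if (m, n) = z0 then f z0 else 0) - g (n + 1) m) has_sum
        (S n - (if n = b then f z0 else 0) - S (n + 1))) UNIV"
      by simp
    show "g n m - (if (m, n) = z0 then f z0 else 0) - g (n + 1) m =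
        q ((m, n + 1) - z0) * (\<i> * f (m, n) - f (m, n + 1)) -
        q ((m + 1, n + 1) - z0) * (\<i> * f (m + 1, n) - f (m + 1, n + 1))" for m
      unfolding g_def using assms(3) n by (intro discrete_Green_identity) (auto simp: Hp_def)
    \<comment> \<open>Both rows of \<open>f\<close> tend to 0 along \<open>h\<close> and
      \<open>q\<close> is bounded, so the flux vanishes at both ends.\<close>
    show "(\<lambda>k. q ((h k, n + 1) - z0) * (\<i> * f (h k, n) - f (h k, n + 1))) \<longlonglongrightarrow> 0"
      if h: "inj h" for h :: "nat \<Rightarrow> int"
    proof -
      have f0: "(\<lambda>k. f (h k, n')) \<longlonglongrightarrow> 0" if "n' \<ge> 0" for n'
        using tendsto_zero_of_powr_summable_on[OF bounded_sums_imp_summable_on(1) h, of "\<lambda>m. f (m, n')" r F]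
          F[OF that] r by simp
      have "(\<lambda>k. \<i> * f (h k, n) - f (h k, n + 1)) \<longlonglongrightarrow> \<i> * 0 - 0"
        using n by (intro tendsto_intros f0) auto
      then have "(\<lambda>k. B * norm (\<i> * f (h k, n) - f (h k, n + 1))) \<longlonglongrightarrow> 0"
        by (intro tendsto_mult_right_zero tendsto_norm_zero) simp
      then show ?thesis
        by (rule Lim_null_comparison[rotated]) (auto simp: norm_mult intro!: mult_right_mono B always_eventually)
    qed
  qed
  \<comment> \<open>Going up from row 0, the row of \<open>z0\<close> is crossed once if
    \<open>b \<ge> 0\<close> and never if \<open>b < 0\<close>. This is the origin of the two cases
    of the theorem.\<close>
  have S_int: "S 0 = (if 0 \<le> b \<and> b < int N then f z0 else 0) + S (int N)" for N
  proof (induction N)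
    case (Suc N)
    then show ?case using step[of "int N"] by (auto simp: algebra_simps split: if_splits)
  qed auto
  have "(\<lambda>N. S (int N)) \<longlonglongrightarrow> 0"
  proof (rule Lim_null_comparison)
    show "\<forall>\<^sub>F N in sequentially. norm (S (int N)) \<le> E (int N) powr (1/4) * F + E (int N) powr d * W"
      using S_bound by simp
    have "filterlim (\<lambda>N. nat \<bar>b - int N\<bar>) at_top sequentially"
      unfolding filterlim_at_top
    proof
      fix Z show "\<forall>\<^sub>F N in sequentially. Z \<le> nat \<bar>b - int N\<bar>"
        using eventually_ge_at_top[of "Z + nat \<bar>b\<bar>"] by eventually_elim linarith
    qed
    then have "(\<lambda>N. e (nat \<bar>b - int N\<bar>)) \<longlonglongrightarrow> 0" by (rule filterlim_compose[OF e])
    moreover have "(\<lambda>N. 1 / (1 + real N)) \<longlonglongrightarrow> 0"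
      using LIMSEQ_inverse_real_of_nat by (simp add: inverse_eq_divide add.commute)
    ultimately have "(\<lambda>N. \<bar>e (nat \<bar>b - int N\<bar>)\<bar> + 1 / (1 + real N)) \<longlonglongrightarrow> \<bar>0\<bar> + 0"
      by (intro tendsto_add tendsto_rabs)
    then have E0: "(\<lambda>N. E (int N)) \<longlonglongrightarrow> 0" by (simp add: E_def)
    have powr0: "(\<lambda>N. E (int N) powr x) \<longlonglongrightarrow> 0" if "x > 0" for x
      using tendsto_powr2[OF E0 tendsto_const, of x] that by (simp add: E_def)
    show "(\<lambda>N. E (int N) powr (1/4) * F + E (int N) powr d * W) \<longlonglongrightarrow> 0"
      using d by (intro tendsto_add_zero tendsto_mult_left_zero powr0) auto
  qed
  \<comment> \<open>Beyond row \<open>b\<close> the row sums no longer change, so their limit 0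
    determines \<open>S 0\<close>.\<close>
  moreover have "\<forall>\<^sub>F N in sequentially. S (int N) = S 0 - (if 0 \<le> b then f z0 else 0)"
    using eventually_gt_at_top[of "nat b"]
  proof eventually_elim
    case (elim N)
    then show ?case using S_int[of N] by (auto split: if_splits)
  qed
  ultimately have "(\<lambda>N::nat. S 0 - (if 0 \<le> b then f z0 else 0)) \<longlonglongrightarrow> 0"
    by (rule Lim_transform_eventually)
  then have "S 0 = (if 0 \<le> b then f z0 else 0)"
    by (simp add: LIMSEQ_const_iff)
  then show ?thesis using S[of 0] by (auto simp: g_def z0)
qed

end
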